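(* Let $\delta$ be a non-commutative derivation on a tracial $W^*$-probability space $(M,\tau)$ which is real and satisfies the coassociativity relation, and assume $1\otimes1\in D(\delta^* )$. Then for all $x\in D(\delta)$: $$\|\delta^*(x\otimes1)\|_2\le\|\delta^*(1\otimes1)\|_2\|x\|,\qquad \|\delta^*(1\otimes x)\|_2\le\|\delta^*(1\otimes1)\|_2\|x\|,$$ $$\|(\mathrm{id}\otimes\tau)(\delta(x))\|_2\le 2\|\delta^*(1\otimes1)\|_2\|x\|,\qquad \|(\tau\otimes\mathrm{id})(\delta(x))\|_2\le 2\|\delta^*(1\otimes1)\|_2\|x\|.$$
   Context: $(M,\tau)$ is a tracial $W^*$-probability space: a von Neumann algebra $M$ with a faithful normal tracial state $\tau$. $L^2(M,\tau)$ is the completion of $M$ for $\|x\|_2=\tau(x^*x)^{1/2}$; $\|x\|$ is the operator norm; inner products are linear in the first variable. The involution of $M$ extends to $L^2(M,\tau)$, and $\tau$ extends by $\tau(\xi)=\langle\xi,1\rangle$. $L^2(M,\tau)\otimes L^2(M,\tau)\cong L^2(M\otimes M,\tau\otimes\tau)$ is an $M$-bimodule via $a\cdot(\xi\otimes\eta)\cdot b=(a\xi)\otimes(\eta b)$; $\odot$ denotes the algebraic tensor product. The involution $\dagger$ on $L^2(M,\tau)\otimes L^2(M,\tau)$ extends $(x_1\otimes x_2)^\dagger=x_2^*\otimes x_1^*$. The slice maps are determined by $(\tau\otimes\mathrm{id})(\xi\otimes\eta)=\tau(\xi)\eta$, $(\mathrm{id}\otimes\tau)(\xi\otimes\eta)=\tau(\eta)\xi$.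 A non-commutative derivation on $M$ is a linear map $\delta:D(\delta)\to L^2(M,\tau)\otimes L^2(M,\tau)$, where $D(\delta)$ is a unital weakly dense $*$-subalgebra of $M$, satisfying $\delta(x_1x_2)=\delta(x_1)\cdot x_2+x_1\cdot\delta(x_2)$; it is regarded as a densely defined unbounded operator from $L^2(M,\tau)$, and $\delta^*$ is its adjoint with domain $D(\delta^* )$. $\delta$ is real if $\delta(x)^\dagger=\delta(x^* )$ for all $x\in D(\delta)$. $\delta$ satisfies the coassociativity relation if $\delta(D(\delta))\subseteq D(\delta)\odot D(\delta)$ and $(\delta\otimes\mathrm{id})\circ\delta=(\mathrm{id}\otimes\delta)\circ\delta$ on $D(\delta)$. *)

theory Defs
  imports "HOL-Analysis.Analysis"
begin

class cvec = real_vector +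
  fixes scaleC :: "complex \<Rightarrow> 'a \<Rightarrow> 'a"
  assumes scaleC_add_right: "scaleC a (x + y) = scaleC a x + scaleC a y"
    and scaleC_add_left: "scaleC (a + b) x = scaleC a x + scaleC b x"
    and scaleC_scaleC: "scaleC a (scaleC b x) = scaleC (a * b) x"
    and scaleC_one: "scaleC 1 x = x"
    and scaleR_scaleC: "scaleR r x = scaleC (complex_of_real r) x"

class cinner_space = cvec + real_normed_vector +
  fixes cinner :: "'a \<Rightarrow> 'a \<Rightarrow> complex"
  assumes cinner_conj: "cinner x y = cnj (cinner y x)"
    and cinner_add_left: "cinner (x + y) z = cinner x z + cinner y z"
    and cinner_scaleC_left: "cinner (scaleC a x) y = a * cinner x y"
    and cinner_self_nonneg: "0 \<le> Re (cinner x x)"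
    and cinner_self_zero: "cinner x x = 0 \<longleftrightarrow> x = 0"
    and norm_cinner: "norm x = sqrt (Re (cinner x x))"

class chilbert = cinner_space + complete_space

definition clinear :: "('a::cvec \<Rightarrow> 'b::cvec) \<Rightarrow> bool" where
  "clinear f \<longleftrightarrow> (\<forall>x y. f (x + y) = f x + f y) \<and> (\<forall>c x. f (scaleC c x) = scaleC c (f x))"

definition cbounded :: "('a::cinner_space \<Rightarrow> 'b::cinner_space) \<Rightarrow> bool" where
  "cbounded f \<longleftrightarrow> clinear f \<and> (\<exists>K. \<forall>x. norm (f x) \<le> K * norm x)"

definition antilinear_bounded :: "('a::cinner_space \<Rightarrow> 'b::cinner_space) \<Rightarrow> bool" where
  "antilinear_bounded f \<longleftrightarrow> (\<forall>x y. f (x + y) = f x + f y)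
      \<and> (\<forall>c x. f (scaleC c x) = scaleC (cnj c) (f x)) \<and> (\<exists>K. \<forall>x. norm (f x) \<le> K * norm x)"

definition adj :: "('a::cinner_space \<Rightarrow> 'b::cinner_space) \<Rightarrow> ('b \<Rightarrow> 'a)" where
  "adj T = (THE S. \<forall>x y. cinner (T x) y = cinner x (S y))"

definition wot_closure :: "('a::cinner_space \<Rightarrow> 'a) set \<Rightarrow> ('a \<Rightarrow> 'a) set" where
  "wot_closure S = {T. cbounded T \<and> (\<forall>F \<epsilon>. finite F \<and> \<epsilon> > 0 \<longrightarrow>
      (\<exists>A\<in>S. \<forall>(\<xi>, \<eta>)\<in>F. cmod (cinner (T \<xi> - A \<xi>) \<eta>) < \<epsilon>))}"

definition unital_star_subalgebra :: "('a::cinner_space \<Rightarrow> 'a) set \<Rightarrow> bool" where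
  "unital_star_subalgebra S \<longleftrightarrow> S \<subseteq> {T. cbounded T} \<and> id \<in> S
     \<and> (\<forall>A\<in>S. \<forall>B\<in>S. (\<lambda>v. A v + B v) \<in> S \<and> A \<circ> B \<in> S)
     \<and> (\<forall>c. \<forall>A\<in>S. (\<lambda>v. scaleC c (A v)) \<in> S)
     \<and> (\<forall>A\<in>S. adj A \<in> S)"

definition von_neumann_algebra :: "('a::cinner_space \<Rightarrow> 'a) set \<Rightarrow> bool" where
  "von_neumann_algebra M \<longleftrightarrow> unital_star_subalgebra M \<and> wot_closure M \<subseteq> M"

text \<open>(M, tau) acting on H = L2(M,tau) with the vector \<Omega> = 1, tau(x) = <x \<Omega>, \<Omega>>,
  and x \<in> M identified with x \<Omega> \<in> L2(M,tau).\<close>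
definition tracial_standard_form :: "('a::chilbert \<Rightarrow> 'a) set \<Rightarrow> 'a \<Rightarrow> bool" where
  "tracial_standard_form M \<Omega> \<longleftrightarrow> von_neumann_algebra M \<and> norm \<Omega> = 1
     \<and> (\<forall>x\<in>M. \<forall>y\<in>M. cinner ((x \<circ> y) \<Omega>) \<Omega> = cinner ((y \<circ> x) \<Omega>) \<Omega>)
     \<and> (\<forall>x\<in>M. x \<Omega> = 0 \<longrightarrow> x = (\<lambda>_. 0))
     \<and> closure ((\<lambda>x. x \<Omega>) ` M) = UNIV"

definition Jop :: "('a::chilbert \<Rightarrow> 'a) set \<Rightarrow> 'a \<Rightarrow> ('a \<Rightarrow> 'a)" where
  "Jop M \<Omega> = (THE J. antilinear_bounded J \<and> (\<forall>y\<in>M. J (y \<Omega>) = adj y \<Omega>))"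

definition right_act :: "('a::chilbert \<Rightarrow> 'a) set \<Rightarrow> 'a \<Rightarrow> ('a \<Rightarrow> 'a) \<Rightarrow> ('a \<Rightarrow> 'a)" where
  "right_act M \<Omega> b = (THE T. cbounded T \<and> (\<forall>y\<in>M. T (y \<Omega>) = (y \<circ> b) \<Omega>))"

definition complex_span :: "'a::cvec set \<Rightarrow> 'a set" where
  "complex_span S = {\<Sum>i<n. scaleC (c i) (v i) | (n::nat) c v. \<forall>i<n. v i \<in> S}"

definition is_htensor :: "('a::chilbert \<Rightarrow> 'b::chilbert \<Rightarrow> 'c::chilbert) \<Rightarrow> bool" where
  "is_htensor t \<longleftrightarrow> (\<forall>x x' y. t (x + x') y = t x y + t x' y)
     \<and> (\<forall>x y y'. t x (y + y') = t x y + t x y')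
     \<and> (\<forall>c x y. t (scaleC c x) y = scaleC c (t x y) \<and> t x (scaleC c y) = scaleC c (t x y))
     \<and> (\<forall>x y x' y'. cinner (t x y) (t x' y') = cinner x x' * cinner y y')
     \<and> closure (complex_span (range (case_prod t))) = UNIV"

definition tensor_op :: "('a::chilbert \<Rightarrow> 'b::chilbert \<Rightarrow> 'c::chilbert)
    \<Rightarrow> ('a \<Rightarrow> 'a) \<Rightarrow> ('b \<Rightarrow> 'b) \<Rightarrow> ('c \<Rightarrow> 'c)" where
  "tensor_op t A B = (THE T. cbounded T \<and> (\<forall>\<xi> \<eta>. T (t \<xi> \<eta>) = t (A \<xi>) (B \<eta>)))"

definition left_actK :: "('a::chilbert \<Rightarrow> 'a \<Rightarrow> 'c::chilbert) \<Rightarrow> ('a \<Rightarrow> 'a) \<Rightarrow> 'c \<Rightarrow> 'c" where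
  "left_actK t a = tensor_op t a id"

definition right_actK :: "('a::chilbert \<Rightarrow> 'a) set \<Rightarrow> 'a \<Rightarrow> ('a \<Rightarrow> 'a \<Rightarrow> 'c::chilbert)
    \<Rightarrow> ('a \<Rightarrow> 'a) \<Rightarrow> 'c \<Rightarrow> 'c" where
  "right_actK M \<Omega> t b = tensor_op t id (right_act M \<Omega> b)"

definition dagger :: "('a::chilbert \<Rightarrow> 'a) set \<Rightarrow> 'a \<Rightarrow> ('a \<Rightarrow> 'a \<Rightarrow> 'c::chilbert) \<Rightarrow> 'c \<Rightarrow> 'c" where
  "dagger M \<Omega> t = (THE D. antilinear_bounded D \<and>
      (\<forall>\<xi> \<eta>. D (t \<xi> \<eta>) = t (Jop M \<Omega> \<eta>) (Jop M \<Omega> \<xi>)))"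

definition slice_id_tau :: "('a::chilbert \<Rightarrow> 'a \<Rightarrow> 'c::chilbert) \<Rightarrow> 'a \<Rightarrow> 'c \<Rightarrow> 'a" where
  "slice_id_tau t \<Omega> = (THE T. cbounded T \<and> (\<forall>\<xi> \<eta>. T (t \<xi> \<eta>) = scaleC (cinner \<eta> \<Omega>) \<xi>))"

definition slice_tau_id :: "('a::chilbert \<Rightarrow> 'a \<Rightarrow> 'c::chilbert) \<Rightarrow> 'a \<Rightarrow> 'c \<Rightarrow> 'a" where
  "slice_tau_id t \<Omega> = (THE T. cbounded T \<and> (\<forall>\<xi> \<eta>. T (t \<xi> \<eta>) = scaleC (cinner \<xi> \<Omega>) \<eta>))"

definition nc_derivation :: "('a::chilbert \<Rightarrow> 'a) set \<Rightarrow> 'a \<Rightarrow> ('a \<Rightarrow> 'a \<Rightarrow> 'c::chilbert)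
    \<Rightarrow> ('a \<Rightarrow> 'a) set \<Rightarrow> (('a \<Rightarrow> 'a) \<Rightarrow> 'c) \<Rightarrow> bool" where
  "nc_derivation M \<Omega> t D \<delta> \<longleftrightarrow> unital_star_subalgebra D \<and> D \<subseteq> M \<and> M \<subseteq> wot_closure D
     \<and> (\<forall>x\<in>D. \<forall>y\<in>D. \<delta> (\<lambda>v. x v + y v) = \<delta> x + \<delta> y)
     \<and> (\<forall>c. \<forall>x\<in>D. \<delta> (\<lambda>v. scaleC c (x v)) = scaleC c (\<delta> x))
     \<and> (\<forall>x\<in>D. \<forall>y\<in>D. \<delta> (x \<circ> y) = right_actK M \<Omega> t y (\<delta> x) + left_actK t x (\<delta> y))"

text \<open>\<delta> as an unbounded operator x\<Omega> \<mapsto> \<delta>(x) from L2(M); domain and value of its adjoint.\<close>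
definition dom_adjoint :: "'a::chilbert \<Rightarrow> ('a \<Rightarrow> 'a) set \<Rightarrow> (('a \<Rightarrow> 'a) \<Rightarrow> 'c::chilbert) \<Rightarrow> 'c set" where
  "dom_adjoint \<Omega> D \<delta> = {\<zeta>. \<exists>\<xi>. \<forall>x\<in>D. cinner (\<delta> x) \<zeta> = cinner (x \<Omega>) \<xi>}"

definition adjoint_op :: "'a::chilbert \<Rightarrow> ('a \<Rightarrow> 'a) set \<Rightarrow> (('a \<Rightarrow> 'a) \<Rightarrow> 'c::chilbert) \<Rightarrow> 'c \<Rightarrow> 'a" where
  "adjoint_op \<Omega> D \<delta> \<zeta> = (THE \<xi>. \<forall>x\<in>D. cinner (\<delta> x) \<zeta> = cinner (x \<Omega>) \<xi>)"

definition real_derivation :: "('a::chilbert \<Rightarrow> 'a) set \<Rightarrow> 'a \<Rightarrow> ('a \<Rightarrow> 'a \<Rightarrow> 'c::chilbert)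
    \<Rightarrow> ('a \<Rightarrow> 'a) set \<Rightarrow> (('a \<Rightarrow> 'a) \<Rightarrow> 'c) \<Rightarrow> bool" where
  "real_derivation M \<Omega> t D \<delta> \<longleftrightarrow> (\<forall>x\<in>D. dagger M \<Omega> t (\<delta> x) = \<delta> (adj x))"

text \<open>Coassociativity: \<delta>(D) \<subseteq> D \<odot> D and (\<delta> \<otimes> id) \<circ> \<delta> = (id \<otimes> \<delta>) \<circ> \<delta>, where
  (L2 \<otimes> L2) \<otimes> L2 and L2 \<otimes> (L2 \<otimes> L2) are identified via tA, tB.\<close>
definition coassociative :: "'a::chilbert \<Rightarrow> ('a \<Rightarrow> 'a \<Rightarrow> 'c::chilbert)
    \<Rightarrow> ('c \<Rightarrow> 'a \<Rightarrow> 'd::chilbert) \<Rightarrow> ('a \<Rightarrow> 'c \<Rightarrow> 'd)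
    \<Rightarrow> ('a \<Rightarrow> 'a) set \<Rightarrow> (('a \<Rightarrow> 'a) \<Rightarrow> 'c) \<Rightarrow> bool" where
  "coassociative \<Omega> t tA tB D \<delta> \<longleftrightarrow>
     (\<forall>x\<in>D. \<exists>(n::nat) a b. (\<forall>i<n. a i \<in> D \<and> b i \<in> D) \<and> \<delta> x = (\<Sum>i<n. t (a i \<Omega>) (b i \<Omega>)))
   \<and> (\<forall>x\<in>D. \<forall>(n::nat) a b. (\<forall>i<n. a i \<in> D \<and> b i \<in> D) \<and> \<delta> x = (\<Sum>i<n. t (a i \<Omega>) (b i \<Omega>))
        \<longrightarrow> (\<Sum>i<n. tA (\<delta> (a i)) (b i \<Omega>)) = (\<Sum>i<n. tB (a i \<Omega>) (\<delta> (b i))))"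

end

theory Submission
  imports Defs
begin

text \<open>Write \<open>\<xi> = \<delta>\<^sup>*(1 \<otimes> 1)\<close> and \<open>\<rho> = (id \<otimes> \<tau>) \<circ> \<delta>\<close>. The Leibniz rule and reality give
  \<open>\<delta>\<^sup>*(x \<otimes> 1) = T x\<close> with \<open>T x = x \<xi> - \<rho> x\<close>, and coassociativity gives
  \<open>\<langle>T y, T x\<rangle> = \<langle>\<xi>, T (y\<^sup>* x)\<rangle>\<close>. Hence \<open>\<parallel>T x\<parallel>\<^sup>2 \<le> \<parallel>\<xi>\<parallel> \<parallel>T (x\<^sup>* x)\<parallel>\<close>; iterating along
  \<open>z\<^sub>0 = x\<close>, \<open>z\<^sub>k\<^sub>+\<^sub>1 = z\<^sub>k\<^sup>* z\<^sub>k\<close>, where \<open>\<parallel>T z\<^sub>k\<parallel> = O(2^k \<parallel>x\<parallel>^(2^k))\<close> by the Leibniz rule, yields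
  \<open>\<parallel>T x\<parallel> \<le> \<parallel>\<xi>\<parallel> \<parallel>x\<parallel>\<close>. The bound on \<open>\<rho>\<close> follows from \<open>\<rho> x = x \<xi> - T x\<close>, and the mirrored
  statements from the modular conjugation \<open>J\<close>.\<close>

section \<open>Complex Hilbert spaces\<close>

lemma scaleC_zero_right [simp]: "scaleC c (0::'a::cvec) = 0"
  using scaleC_add_right[of c "0::'a" 0] by simp

lemma scaleC_zero_left [simp]: "scaleC 0 (x::'a::cvec) = 0"
  using scaleC_add_left[of 0 0 x] by simp

lemma scaleC_minus_one [simp]: "scaleC (- 1) (x::'a::cvec) = - x"
  using scaleC_add_left[of 1 "- 1" x] by (simp add: scaleC_one eq_neg_iff_add_eq_0 add.commute)

lemma cinner_scaleC_right: "cinner x (scaleC a y) = cnj a * cinner x (y::'a::cinner_space)"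
  by (metis cinner_conj cinner_scaleC_left complex_cnj_mult)

lemma cinner_add_right: "cinner x (y + z) = cinner x y + cinner x (z::'a::cinner_space)"
  by (metis cinner_conj cinner_add_left complex_cnj_add)

lemma cinner_zero_left [simp]: "cinner 0 (x::'a::cinner_space) = 0"
  using cinner_add_left[of 0 0 x] by simp

lemma cinner_zero_right [simp]: "cinner (x::'a::cinner_space) 0 = 0"
  using cinner_add_right[of x 0 0] by simp

lemma cinner_minus_right [simp]: "cinner x (- y::'a::cinner_space) = - cinner x y"
  using cinner_add_right[of x y "- y"] by (simp add: eq_neg_iff_add_eq_0 add.commute)

lemma cinner_self: "cinner x x = complex_of_real ((norm (x::'a::cinner_space))\<^sup>2)"
proof -
  have "Im (cinner x x) = 0"
    by (metis cinner_conj cnj.simps(2) neg_equal_zero)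
  moreover have "Re (cinner x x) = (norm x)\<^sup>2"
    by (simp add: norm_cinner cinner_self_nonneg)
  ultimately show ?thesis by (simp add: complex_eq_iff)
qed

lemma norm_scaleC: "norm (scaleC c x) = cmod c * norm (x::'a::cinner_space)"
proof -
  have "complex_of_real ((norm (scaleC c x))\<^sup>2) = (c * cnj c) * complex_of_real ((norm x)\<^sup>2)"
    by (metis cinner_self cinner_scaleC_left cinner_scaleC_right mult.assoc)
  also have "\<dots> = complex_of_real ((cmod c * norm x)\<^sup>2)"
    by (simp add: complex_norm_square[symmetric] power_mult_distrib)
  finally have "(norm (scaleC c x))\<^sup>2 = (cmod c * norm x)\<^sup>2"
    using of_real_eq_iff by blast
  then show ?thesis by (simp add: power2_eq_iff_nonneg)
qed

lemma norm_add_square: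
  "(norm (x + y))\<^sup>2 = (norm x)\<^sup>2 + (norm (y::'a::cinner_space))\<^sup>2 + 2 * Re (cinner x y)"
proof -
  have "complex_of_real ((norm (x + y))\<^sup>2) =
      complex_of_real ((norm x)\<^sup>2) + complex_of_real ((norm y)\<^sup>2) + (cinner x y + cnj (cinner x y))"
    by (simp add: cinner_self[symmetric] cinner_add_left cinner_add_right cinner_conj[symmetric]
        del: of_real_power)
  then have "Re (complex_of_real ((norm (x + y))\<^sup>2)) =
      Re (complex_of_real ((norm x)\<^sup>2) + complex_of_real ((norm y)\<^sup>2) + (cinner x y + cnj (cinner x y)))"
    by (rule arg_cong)
  then show ?thesis by simp
qed

lemma cinner_cauchy_schwarz: "cmod (cinner x y) \<le> norm x * norm (y::'a::cinner_space)"
proof (cases "y = 0")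
  case False
  \<comment> \<open>With this \<open>c\<close> the vector \<open>x + scaleC c y\<close> is
    orthogonal to \<open>y\<close>, so its norm is the least possible one.\<close>
  define c where "c = - cinner x y / complex_of_real ((norm y)\<^sup>2)"
  have "0 \<le> (norm (x + scaleC c y))\<^sup>2" by simp
  also have "\<dots> = (norm x)\<^sup>2 + (cmod c * norm y)\<^sup>2 + 2 * Re (cnj c * cinner x y)"
    by (simp add: norm_add_square norm_scaleC cinner_scaleC_right)
  also have "cnj c * cinner x y = - complex_of_real ((cmod (cinner x y))\<^sup>2 / (norm y)\<^sup>2)"
    using complex_norm_square[of "cinner x y"] by (simp add: c_def mult.commute)
  also have "(cmod c * norm y)\<^sup>2 = (cmod (cinner x y))\<^sup>2 / (norm y)\<^sup>2"
    proof -
    have "cmod c = cmod (cinner x y) / (norm y)\<^sup>2" by (simp add: c_def norm_divide norm_power)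
    then show ?thesis using False by (simp add: power2_eq_square)
  qed
  finally have "(cmod (cinner x y))\<^sup>2 / (norm y)\<^sup>2 \<le> (norm x)\<^sup>2" by simp
  then have "(cmod (cinner x y))\<^sup>2 \<le> (norm x * norm y)\<^sup>2"
    using False by (simp add: divide_le_eq power_mult_distrib)
  then show ?thesis by (rule power2_le_imp_le) simp
qed simp

text \<open>Viewing \<open>cinner\<close> as real bilinear and bounded makes its continuity and its
  rules for sums and differences available under the prefix \<open>cinner\<close>.\<close>

interpretation cinner: bounded_bilinear "cinner :: 'a::cinner_space \<Rightarrow> 'a \<Rightarrow> complex"
proof
  show "\<exists>K. \<forall>a b. norm (cinner a (b::'a)) \<le> norm a * norm b * K"
    by (rule exI[of _ 1]) (simp add: cinner_cauchy_schwarz)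
qed (simp_all add: cinner_add_left cinner_add_right scaleR_scaleC cinner_scaleC_left
    cinner_scaleC_right scaleR_conv_of_real)

lemma cinner_eqI: "x = y" if "\<And>z. cinner z x = cinner z (y::'a::cinner_space)"
proof -
  have "cinner (x - y) (x - y) = 0"
    using that[of "x - y"] by (simp add: cinner.diff_right)
  then show ?thesis by (simp add: cinner_self_zero)
qed

lemma cinner_dense_eqI:
  assumes "closure S = UNIV" and "\<And>z. z \<in> S \<Longrightarrow> cinner z x = cinner z (y::'a::cinner_space)"
  shows "x = y"
proof (rule cinner_eqI)
  fix z
  have "closed {z. cinner z x = cinner z y}"
    by (intro closed_Collect_eq continuous_intros cinner.continuous_on)
  moreover have "S \<subseteq> {z. cinner z x = cinner z y}" using assms(2) by blast
  ultimately have "closure S \<subseteq> {z. cinner z x = cinner z y}" by (rule closure_minimal[rotated])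
  then show "cinner z x = cinner z y" using assms(1) by blast
qed

text \<open>The twist \<sigma> is the identity for linear maps and \<open>cnj\<close> for antilinear
  ones, so that extension from dense subspaces is proved once for both.\<close>

definition semilinear_bounded ::
  "(complex \<Rightarrow> complex) \<Rightarrow> ('a::cinner_space \<Rightarrow> 'b::cinner_space) \<Rightarrow> bool" where
  "semilinear_bounded \<sigma> f \<longleftrightarrow> (\<forall>x y. f (x + y) = f x + f y)
      \<and> (\<forall>c x. f (scaleC c x) = scaleC (\<sigma> c) (f x)) \<and> (\<exists>K. \<forall>x. norm (f x) \<le> K * norm x)"

lemma cbounded_semilinear: "cbounded f \<longleftrightarrow> semilinear_bounded (\<lambda>c. c) f"
  by (auto simp: cbounded_def clinear_def semilinear_bounded_def)

lemma antilinear_semilinear: "antilinear_bounded f \<longleftrightarrow> semilinear_bounded cnj f"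
  by (auto simp: antilinear_bounded_def semilinear_bounded_def)

text \<open>Both twists fix the real scalars, so linear and antilinear maps alike are bounded
  real-linear maps. Continuity and, for linear maps, \<open>onorm\<close> are then at hand.\<close>

lemma semilinear_bounded_linear:
  assumes "semilinear_bounded \<sigma> f" and "\<And>r. \<sigma> (complex_of_real r) = complex_of_real r"
  shows "bounded_linear f"
proof -
  obtain K where "\<And>x. norm (f x) \<le> K * norm x"
    using assms(1) unfolding semilinear_bounded_def by blast
  then show ?thesis
    using assms by (intro bounded_linear_intro[of f K])
      (auto simp: semilinear_bounded_def scaleR_scaleC mult.commute)
qed

lemmas cbounded_bounded_linear = semilinear_bounded_linear[of "\<lambda>c. c", folded cbounded_semilinear,
    simplified]
lemmas antilinear_bounded_linear = semilinear_bounded_linear[of cnj, folded antilinear_semilinear,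
    simplified]

lemma cbounded_scaleC: "cbounded f \<Longrightarrow> f (scaleC c x) = scaleC c (f x)"
  by (simp add: cbounded_def clinear_def)

lemma antilinear_scaleC: "antilinear_bounded f \<Longrightarrow> f (scaleC c x) = scaleC (cnj c) (f x)"
  by (simp add: antilinear_bounded_def)

lemma cbounded_add: "cbounded f \<Longrightarrow> f (x + y) = f x + f y"
  by (simp add: cbounded_def clinear_def)

lemma cboundedI:
  assumes "\<And>x y. f (x + y) = f x + f y" and "\<And>c x. f (scaleC c x) = scaleC c (f x)"
    and "\<And>x. norm (f x) \<le> K * norm x"
  shows "cbounded f"
  using assms by (auto simp: cbounded_def clinear_def)

lemma cbounded_comp:
  assumes f: "cbounded f" and g: "cbounded g" shows "cbounded (f \<circ> g)"
  using bounded_linear_compose[OF f[THEN cbounded_bounded_linear] g[THEN cbounded_bounded_linear],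
      THEN bounded_linear.bounded]
    f g by (auto simp: cbounded_def clinear_def mult.commute)

lemma cbounded_onorm: "cbounded f \<Longrightarrow> norm (f x) \<le> onorm f * norm x"
  by (simp add: onorm cbounded_bounded_linear)

lemma cbounded_onorm_nonneg: "cbounded f \<Longrightarrow> 0 \<le> onorm f"
  by (simp add: onorm_pos_le cbounded_bounded_linear)

lemma dense_eq:
  assumes "bounded_linear f" and "bounded_linear g" and "closure S = UNIV"
    and "\<And>x. x \<in> S \<Longrightarrow> f x = g x"
  shows "f = (g :: 'a::real_normed_vector \<Rightarrow> 'b::real_normed_vector)"
proof
  fix x
  have "closed {x. f x = g x}"
    using assms(1,2) by (intro closed_Collect_eq) (auto intro: linear_continuous_on)
  then have "closure S \<subseteq> {x. f x = g x}" using assms(4) by (intro closure_minimal) auto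
  then show "f x = g x" using assms(3) by auto
qed

text \<open>The representing vector is the minimiser of \<open>\<parallel>v\<parallel>\<^sup>2 - 2 Re (f v)\<close>.\<close>
lemma riesz_representation:
  fixes f :: "'a::chilbert \<Rightarrow> complex"
  assumes add: "\<And>x y. f (x + y) = f x + f y" and scale: "\<And>c x. f (scaleC c x) = c * f x"
    and K: "\<And>x. cmod (f x) \<le> K * norm x"
  obtains u where "\<And>x. f x = cinner x u"
proof -
  define g where "g v = (norm v)\<^sup>2 - 2 * Re (f v)" for v
  have f_real: "f (r *\<^sub>R v) = of_real r * f v" for r v
    by (simp add: scaleR_scaleC scale)
  \<comment> \<open>Completing the square in \<open>(norm v)\<^sup>2 - 2 * K * norm v\<close> bounds
    \<open>g\<close> from below.\<close>
  have lower: "- (K\<^sup>2) \<le> g v" for v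
  proof -
    have "Re (f v) \<le> K * norm v"
      using K[of v] complex_Re_le_cmod[of "f v"] by linarith
    moreover have "0 \<le> (norm v - K)\<^sup>2" by simp
    ultimately show ?thesis by (simp add: g_def power2_diff mult.commute)
  qed
  define m where "m = Inf (range g)"
  have bdd: "bdd_below (range g)" using lower by (auto intro!: bdd_belowI)
  have m_le: "m \<le> g v" for v unfolding m_def using bdd by (simp add: cInf_lower)
  have "\<exists>v. g v < m + 1 / real (Suc n)" for n
    using cInf_lessD[of "range g" "m + 1 / real (Suc n)"] by (auto simp: m_def)
  then obtain v where v: "\<And>n. g (v n) < m + 1 / real (Suc n)" by metis
  \<comment> \<open>Parallelogram identity; the linear terms cancel because \<open>f\<close> at the
    midpoint is the mean of its values.\<close>
  have par: "(norm (a - b))\<^sup>2 = 2 * g a + 2 * g b - 4 * g ((1/2) *\<^sub>R (a + b))" for a b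
  proof -
    have 1: "(norm (a - b))\<^sup>2 = (norm a)\<^sup>2 + (norm b)\<^sup>2 - 2 * Re (cinner a b)"
      using norm_add_square[of a "- b"] by simp
    have 2: "Re (f ((1/2) *\<^sub>R (a + b))) = (Re (f a) + Re (f b)) / 2"
      unfolding f_real add by simp
    have 3: "(norm ((1/2) *\<^sub>R (a + b)))\<^sup>2 = (norm (a + b))\<^sup>2 / 4"
      by (simp add: power_divide)
    show ?thesis unfolding g_def 2 3 using 1 norm_add_square[of a b] by (simp add: field_simps)
  qed
  \<comment> \<open>The value of \<open>g\<close> at the midpoint is at least \<open>m\<close>, so
    only the excesses of \<open>g (v i)\<close> and \<open>g (v j)\<close> over \<open>m\<close>
    remain.\<close>
  have close: "(norm (v i - v j))\<^sup>2 \<le> 2 * (1 / real (Suc i)) + 2 * (1 / real (Suc j))" for i j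
    using par[of "v i" "v j"] v[of i] v[of j] m_le[of "(1/2) *\<^sub>R (v i + v j)"] by linarith
  have "Cauchy v"
  proof (rule CauchyI)
    fix e :: real assume e: "0 < e"
    obtain N where N: "4 / real (Suc N) < e\<^sup>2"
      using reals_Archimedean[of "e\<^sup>2 / 4"] e by (auto simp: field_simps)
    have "norm (v i - v j) < e" if "N \<le> i" "N \<le> j" for i j
    proof (rule power2_less_imp_less)
      have "2 / real (Suc i) \<le> 2 / real (Suc N)" "2 / real (Suc j) \<le> 2 / real (Suc N)"
        using that by (auto intro!: divide_left_mono)
      then show "(norm (v i - v j))\<^sup>2 < e\<^sup>2" using close[of i j] N by linarith
    qed (use e in simp)
    then show "\<exists>M. \<forall>m\<ge>M. \<forall>n\<ge>M. norm (v m - v n) < e" by blast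
  qed
  then obtain u where u: "v \<longlonglongrightarrow> u" using Cauchy_convergent convergent_def by blast
  have blin: "bounded_linear f"
    by (rule bounded_linear_intro[of f K]) (auto simp: add f_real K mult.commute scaleR_conv_of_real)
  have "(\<lambda>n. g (v n)) \<longlonglongrightarrow> g u"
    unfolding g_def by (intro tendsto_intros u bounded_linear.tendsto[OF blin])
  moreover have "(\<lambda>n. m + 1 / real (Suc n)) \<longlonglongrightarrow> m + 0"
    by (intro tendsto_intros) (use LIMSEQ_inverse_real_of_nat in \<open>simp add: inverse_eq_divide\<close>)
  ultimately have gu: "g u \<le> m"
    using LIMSEQ_le[of "\<lambda>n. g (v n)" "g u" "\<lambda>n. m + 1 / real (Suc n)" m] v less_imp_le by auto
  \<comment> \<open>First-order condition at the minimiser \<open>u\<close> along the real line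
    through \<open>u\<close> in direction \<open>h\<close>.\<close>
  have Re_eq: "Re (f h) = Re (cinner h u)" for h
  proof -
    define d where "d = Re (cinner u h) - Re (f h)"
    have ineq: "0 \<le> s\<^sup>2 * (norm h)\<^sup>2 + 2 * s * d" for s :: real
    proof -
      have "g (u + s *\<^sub>R h) = g u + s\<^sup>2 * (norm h)\<^sup>2 + 2 * s * d"
        by (simp add: g_def norm_add_square add f_real cinner.scaleR_right d_def power_mult_distrib algebra_simps)
      then show ?thesis using m_le[of "u + s *\<^sub>R h"] gu by linarith
    qed
    have "d = 0"
    proof (cases "h = 0")
      case True
      then show ?thesis using f_real[of 0 h] by (simp add: d_def)
    next
      case False
      \<comment> \<open>The chosen \<open>s\<close> minimises the quadratic in \<open>ineq\<close>;
        nonnegativity there forces \<open>d = 0\<close>.\<close>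
      have "0 \<le> (- d / (norm h)\<^sup>2)\<^sup>2 * (norm h)\<^sup>2 + 2 * (- d / (norm h)\<^sup>2) * d" by (rule ineq)
      also have "\<dots> = - (d\<^sup>2 / (norm h)\<^sup>2)" using False by (simp add: power2_eq_square field_simps)
      finally have "d\<^sup>2 / (norm h)\<^sup>2 \<le> 0" by simp
      then show ?thesis using False by (simp add: divide_le_0_iff)
    qed
    then show ?thesis by (metis cinner_conj cnj.simps(1) d_def eq_iff_diff_eq_0)
  qed
  have "f x = cinner x u" for x
  proof (rule complex_eqI)
    \<comment> \<open>Multiplying the argument by the imaginary unit turns imaginary parts into real
      parts, up to sign.\<close>
    show "Im (f x) = Im (cinner x u)"
      using Re_eq[of "scaleC \<i> x"] by (simp add: scale cinner_scaleC_left)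
  qed (rule Re_eq)
  then show thesis using that by blast
qed

section \<open>Adjoints of bounded operators\<close>

lemma adj_exists:
  fixes T :: "'a::chilbert \<Rightarrow> 'b::cinner_space"
  assumes "cbounded T"
  shows "\<exists>S. \<forall>x y. cinner (T x) y = cinner x (S y)"
proof -
  have "\<exists>u. \<forall>x. cinner (T x) y = cinner x u" for y
  proof -
    have "cmod (cinner (T x) y) \<le> (onorm T * norm y) * norm x" for x
      using order_trans[OF cinner_cauchy_schwarz mult_right_mono[OF cbounded_onorm[OF assms]]]
      by (simp add: mult_ac)
    then obtain u where "\<And>x. cinner (T x) y = cinner x u"
      using riesz_representation[of "\<lambda>x. cinner (T x) y"]
        cbounded_add[OF assms] cbounded_scaleC[OF assms]
      by (metis cinner_add_left cinner_scaleC_left)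
    then show ?thesis by blast
  qed
  then show ?thesis by metis
qed

text \<open>Resolves the \<open>THE\<close> in \<open>adj\<close>: existence comes from the Riesz
  representation, uniqueness from nondegeneracy of \<open>cinner\<close>.\<close>

lemma cinner_adj_right:
  fixes T :: "'a::chilbert \<Rightarrow> 'b::cinner_space"
  assumes "cbounded T" shows "cinner x (adj T y) = cinner (T x) y"
proof -
  obtain S where S: "\<forall>x y. cinner (T x) y = cinner x (S y)" using adj_exists[OF assms] by blast
  have "adj T = S" unfolding adj_def
  proof (rule the_equality)
    fix S' assume "\<forall>x y. cinner (T x) y = cinner x (S' y)"
    then show "S' = S" using S by (intro ext cinner_eqI) metis
  qed (rule S)
  then show ?thesis using S by simp
qed

lemma cinner_adj_left:
  fixes T :: "'a::chilbert \<Rightarrow> 'b::cinner_space"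
  assumes "cbounded T" shows "cinner (adj T y) x = cinner y (T x)"
  by (metis assms cinner_adj_right cinner_conj)

lemma norm_adj_le:
  fixes T :: "'a::chilbert \<Rightarrow> 'b::cinner_space"
  assumes "cbounded T" shows "norm (adj T y) \<le> onorm T * norm y"
proof -
  have "(norm (adj T y))\<^sup>2 = cmod (cinner (adj T y) (adj T y))"
    by (simp add: cinner_self del: of_real_power)
  also have "\<dots> = cmod (cinner (T (adj T y)) y)" by (simp add: cinner_adj_right assms)
  also have "\<dots> \<le> onorm T * norm (adj T y) * norm y"
    using order_trans[OF cinner_cauchy_schwarz mult_right_mono[OF cbounded_onorm[OF assms]]] by auto
  finally have "norm (adj T y) * norm (adj T y) \<le> norm (adj T y) * (onorm T * norm y)"
    by (simp add: power2_eq_square mult_ac)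
  then show ?thesis
    by (cases "adj T y = 0") (use cbounded_onorm_nonneg[OF assms] in auto)
qed

lemma cbounded_adj:
  fixes T :: "'a::chilbert \<Rightarrow> 'b::cinner_space"
  assumes "cbounded T" shows "cbounded (adj T)"
  by (rule cboundedI[OF _ _ norm_adj_le[OF assms]]; rule cinner_eqI)
    (simp_all add: cinner_adj_right assms cinner_add_right cinner_scaleC_right)

lemma adj_adj:
  fixes T :: "'a::chilbert \<Rightarrow> 'b::chilbert"
  assumes "cbounded T" shows "adj (adj T) = T"
  by (rule ext, rule cinner_eqI) (simp add: cinner_adj_right cinner_adj_left cbounded_adj assms)

lemma adj_id: "adj id = (id :: 'a::chilbert \<Rightarrow> 'a)"
proof -
  have "cbounded (id :: 'a \<Rightarrow> 'a)" by (rule cboundedI[of _ 1]) auto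
  then show ?thesis by (intro ext cinner_eqI) (simp add: cinner_adj_right)
qed

lemma adj_comp:
  fixes S :: "'b::chilbert \<Rightarrow> 'c::cinner_space" and T :: "'a::chilbert \<Rightarrow> 'b"
  assumes "cbounded S" and "cbounded T" shows "adj (S \<circ> T) = adj T \<circ> adj S"
  by (rule ext, rule cinner_eqI) (simp add: cinner_adj_right cbounded_comp assms)

lemma onorm_adj:
  fixes T :: "'a::chilbert \<Rightarrow> 'b::chilbert"
  assumes "cbounded T" shows "onorm (adj T) = onorm T"
proof (rule antisym)
  show "onorm (adj T) \<le> onorm T"
    by (intro onorm_bound norm_adj_le assms cbounded_onorm_nonneg)
  show "onorm T \<le> onorm (adj T)"
    using norm_adj_le[OF cbounded_adj[OF assms]] cbounded_onorm_nonneg[OF cbounded_adj[OF assms]]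
    by (intro onorm_bound) (simp_all add: adj_adj assms)
qed

section \<open>Iterated squares and Hilbert tensor products\<close>

text \<open>Iterating \<open>rec\<close> gives \<open>c * N 0 ^ n \<le> c ^ n * N k\<close> with
  \<open>n = 2 ^ k\<close>. If \<open>N 0 > c * s\<close>, then \<open>x = c * s / N 0\<close> is
  below 1 and \<open>growth\<close> yields \<open>c \<le> C * n * x ^ n\<close>. The right side
  tends to 0, so the constant \<open>C\<close> and the factor \<open>2 ^ k\<close> disappear from
  the result.\<close>

lemma quadratic_recursion_bound:
  fixes N :: "nat \<Rightarrow> real"
  assumes nonneg: "0 \<le> N 0" "0 \<le> c" "0 \<le> s"
    and rec: "\<And>k. (N k)\<^sup>2 \<le> c * N (Suc k)"
    and growth: "\<And>k. N k \<le> C * 2 ^ k * s ^ (2 ^ k)"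
  shows "N 0 \<le> c * s"
proof (rule ccontr)
  assume less: "\<not> N 0 \<le> c * s"
  \<comment> \<open>For \<open>s = 0\<close> the growth bound at \<open>k = 0\<close> gives
    \<open>N 0 \<le> 0\<close>; for \<open>c = 0\<close> the recursion does.\<close>
  have "s \<noteq> 0" using growth[of 0] less nonneg by auto
  then have s: "0 < s" using nonneg by simp
  have "c \<noteq> 0" using rec[of 0] less nonneg by auto
  then have c: "0 < c" using nonneg by simp
  \<comment> \<open>The extra factor \<open>c\<close> on both sides avoids the exponent
    \<open>2 ^ k - 1\<close>.\<close>
  have iter: "c * N 0 ^ (2 ^ k) \<le> c ^ (2 ^ k) * N k" for k
  proof (induction k)
    case (Suc k)
    have "c * (c * N 0 ^ (2 ^ Suc k)) = (c * N 0 ^ (2 ^ k))\<^sup>2"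
      by (simp add: power_mult_distrib power2_eq_square mult_ac power_add[symmetric] mult_2[of "2 ^ k"])
    also have "\<dots> \<le> (c ^ (2 ^ k) * N k)\<^sup>2"
      using Suc c nonneg by (intro power_mono) auto
    also have "\<dots> = c ^ (2 ^ Suc k) * (N k)\<^sup>2"
      by (simp add: power_mult_distrib power2_eq_square power_add[symmetric] mult_2[of "2 ^ k"])
    also have "\<dots> \<le> c ^ (2 ^ Suc k) * (c * N (Suc k))"
      using rec c by (intro mult_left_mono) auto
    finally have "c * (c * N 0 ^ (2 ^ Suc k)) \<le> c * (c ^ (2 ^ Suc k) * N (Suc k))"
      by (simp add: mult_ac)
    then show ?case using c by (simp del: power_Suc)
  qed simp
  define x where "x = c * s / N 0"
  have N0: "0 < N 0" using less c s by (meson less_le_trans mult_nonneg_nonneg not_le less_imp_le le_less_trans)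
  have x: "0 < x" "x < 1" using less c s N0 by (auto simp: x_def)
  have bound: "c \<le> C * (real (2 ^ k) * x ^ (2 ^ k))" for k
  proof -
    have "c * N 0 ^ (2 ^ k) \<le> c ^ (2 ^ k) * (C * 2 ^ k * s ^ (2 ^ k))"
      using order_trans[OF iter mult_left_mono[OF growth]] c by simp
    then show ?thesis using N0
      by (simp add: x_def power_divide power_mult_distrib field_simps)
  qed
  have "(\<lambda>n. C * (real n * x ^ n)) \<longlonglongrightarrow> C * 0"
    using x by (intro tendsto_mult tendsto_const powser_times_n_limit_0) auto
  then have "eventually (\<lambda>n. C * (real n * x ^ n) < c) sequentially"
    using c by (simp add: order_tendsto_iff)
  then obtain n where n: "\<And>m. m \<ge> n \<Longrightarrow> C * (real m * x ^ m) < c"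
    unfolding eventually_sequentially by blast
  \<comment> \<open>The estimate \<open>bound\<close> covers powers of two only, so the
    contradiction is taken at \<open>m = 2 ^ n\<close>.\<close>
  have "n \<le> 2 ^ n" by (simp add: less_imp_le)
  then show False using n[of "2 ^ n"] bound[of n] by simp
qed

text \<open>For \<open>k > 0\<close> this is the power of \<open>adj a \<circ> a\<close> with
  exponent \<open>2 ^ (k - 1)\<close>; the recursive form matches
  \<open>quadratic_recursion_bound\<close>.\<close>

primrec star_pow :: "('a::chilbert \<Rightarrow> 'a) \<Rightarrow> nat \<Rightarrow> 'a \<Rightarrow> 'a" where
  "star_pow a 0 = a"
| "star_pow a (Suc k) = adj (star_pow a k) \<circ> star_pow a k"

lemma cbounded_star_pow: "cbounded a \<Longrightarrow> cbounded (star_pow a k)"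
  by (induction k) (auto intro: cbounded_comp cbounded_adj)

text \<open>Each step at most squares the norm, because \<open>adj\<close> preserves
  \<open>onorm\<close>.\<close>

lemma onorm_star_pow:
  assumes "cbounded a" shows "onorm (star_pow a k) \<le> onorm a ^ (2 ^ k)"
proof (induction k)
  case (Suc k)
  let ?z = "star_pow a k"
  have z: "cbounded ?z" by (simp add: assms cbounded_star_pow)
  have "onorm (star_pow a (Suc k)) \<le> onorm ?z * onorm ?z"
    using onorm_compose[OF cbounded_bounded_linear cbounded_bounded_linear, OF cbounded_adj[OF z] z]
    by (simp add: onorm_adj z)
  also have "\<dots> \<le> onorm a ^ (2 ^ k) * onorm a ^ (2 ^ k)"
    using Suc z cbounded_onorm_nonneg assms by (intro mult_mono) auto
  finally show ?case by (simp add: power_add[symmetric] mult_2 comp_def)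
qed simp

section \<open>Extension of bounded maps from dense subspaces\<close>

lemma bounded_linear_scaleC: "bounded_linear (scaleC c :: 'a::cinner_space \<Rightarrow> 'a)"
  by (rule bounded_linear_intro[of _ "cmod c"])
    (auto simp: scaleC_add_right norm_scaleC scaleR_scaleC scaleC_scaleC mult.commute)

text \<open>The bound makes \<open>g\<close> Lipschitz on the subspace \<open>U\<close>, so it
  extends uniformly continuously to the closure. Additivity, homogeneity and the bound are closed
  conditions and pass to the limit.\<close>

lemma semilinear_extension:
  fixes g :: "'a::cinner_space \<Rightarrow> 'b::chilbert"
  assumes dense: "closure U = UNIV"
    and U_add: "\<And>x y. x \<in> U \<Longrightarrow> y \<in> U \<Longrightarrow> x + y \<in> U"
    and U_scale: "\<And>c x. x \<in> U \<Longrightarrow> scaleC c x \<in> U"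
    and g_add: "\<And>x y. x \<in> U \<Longrightarrow> y \<in> U \<Longrightarrow> g (x + y) = g x + g y"
    and g_scale: "\<And>c x. x \<in> U \<Longrightarrow> g (scaleC c x) = scaleC (\<sigma> c) (g x)"
    and bound: "\<And>x. x \<in> U \<Longrightarrow> norm (g x) \<le> K * norm x" and K: "0 \<le> K"
  obtains G where "semilinear_bounded \<sigma> G" and "\<And>x. x \<in> U \<Longrightarrow> G x = g x"
    and "\<And>x. norm (G x) \<le> K * norm x"
proof -
  have U_uminus: "- x \<in> U" if "x \<in> U" for x using U_scale[OF that, of "- 1"] by simp
  have g_diff: "g x - g y = g (x - y)" if "x \<in> U" "y \<in> U" for x y
    using g_add[of "x - y" y] U_add[OF that(1) U_uminus[OF that(2)]] that by simp
  have "K-lipschitz_on U g"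
  proof (rule lipschitz_onI)
    fix x y assume "x \<in> U" "y \<in> U"
    then show "dist (g x) (g y) \<le> K * dist x y"
      using bound[of "x - y"] U_add[of x "- y"] U_uminus by (simp add: dist_norm g_diff)
  qed (rule K)
  then obtain G where G: "uniformly_continuous_on UNIV G" "\<And>x. x \<in> U \<Longrightarrow> g x = G x"
    using uniformly_continuous_on_extension_on_closure[OF lipschitz_on_uniformly_continuous]
    by (metis dense)
  have cont: "continuous_on UNIV G" using G(1) by (rule uniformly_continuous_imp_continuous)
  have contG: "continuous_on UNIV (\<lambda>x. G (f x))" if "continuous_on UNIV f" for f :: "'a \<Rightarrow> 'a"
    using continuous_on_compose2[OF cont that] by simp
  have ext: "P x" if "closed {x. P x}" "\<And>x. x \<in> U \<Longrightarrow> P x" for P x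
    using closure_minimal[of U "{x. P x}"] that dense by auto
  \<comment> \<open>Density is used in one variable at a time: first in \<open>y\<close> with
    \<open>x\<close> in \<open>U\<close>, then in \<open>x\<close>.\<close>
  have add1: "G (x + y) = G x + G y" if x: "x \<in> U" for x y
  proof (rule ext[of "\<lambda>y. G (x + y) = G x + G y"])
    show "closed {y. G (x + y) = G x + G y}"
      by (intro closed_Collect_eq contG continuous_intros cont)
    show "G (x + y) = G x + G y" if "y \<in> U" for y
      using G(2) g_add[OF x that] U_add x that by simp
  qed
  have add: "G (x + y) = G x + G y" for x y
  proof (rule ext[of "\<lambda>x. G (x + y) = G x + G y"])
    show "closed {x. G (x + y) = G x + G y}"
      by (intro closed_Collect_eq contG continuous_intros cont)
  qed (rule add1)
  have scale: "G (scaleC c x) = scaleC (\<sigma> c) (G x)" for c x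
  proof (rule ext[of "\<lambda>x. G (scaleC c x) = scaleC (\<sigma> c) (G x)"])
    show "closed {x. G (scaleC c x) = scaleC (\<sigma> c) (G x)}"
      by (intro closed_Collect_eq contG bounded_linear.continuous_on[OF bounded_linear_scaleC]
          continuous_on_id cont)
    show "G (scaleC c x) = scaleC (\<sigma> c) (G x)" if "x \<in> U" for x
      using G(2)[symmetric] g_scale[OF that] U_scale that by simp
  qed
  have norm_le: "norm (G x) \<le> K * norm x" for x
  proof (rule ext[of "\<lambda>x. norm (G x) \<le> K * norm x"])
    show "closed {x. norm (G x) \<le> K * norm x}"
      by (intro closed_Collect_le continuous_intros cont)
    show "norm (G x) \<le> K * norm x" if "x \<in> U" for x
      using G(2)[symmetric] bound that by simp
  qed
  show thesis
    using that[of G] add scale norm_le G(2) by (auto simp: semilinear_bounded_def)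
qed

text \<open>A list of pairs represents an element of the algebraic tensor product, and
  \<open>tsum P\<close> evaluates it with \<open>P\<close> in place of the tensor. Representations
  are not unique; independence of the list is settled in \<open>htensor_extension\<close>.\<close>

definition tsum :: "('a \<Rightarrow> 'b \<Rightarrow> 'c::comm_monoid_add) \<Rightarrow> ('a \<times> 'b) list \<Rightarrow> 'c" where
  "tsum P l = (\<Sum>(x, y)\<leftarrow>l. P x y)"

lemma tsum_simps [simp]:
  "tsum P [] = 0" "tsum P ((x, y) # l) = P x y + tsum P l"
  "tsum P (l @ l') = tsum P l + tsum P l'"
  by (simp_all add: tsum_def)

lemma tsum_upt: "tsum P (map (\<lambda>i. (a i, b i)) [0..<n]) = (\<Sum>i<n. P (a i) (b i))"
  by (induction n) (simp_all add: add.commute)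

lemma linear_tsum: "linear f \<Longrightarrow> f (tsum P l) = tsum (\<lambda>x y. f (P x y)) l"
  by (induction l) (auto simp: linear_0 linear_add)

lemma cinner_tsum_left: "cinner (tsum P l) w = tsum (\<lambda>x y. cinner (P x y) w) l"
  by (induction l) (auto simp: cinner_add_left)

lemma cinner_tsum_right: "cinner w (tsum P l) = tsum (\<lambda>x y. cinner w (P x y)) l"
  by (induction l) (auto simp: cinner_add_right)

lemma tsum_cong: "(\<And>x y. P x y = Q x y) \<Longrightarrow> tsum P l = tsum Q l"
  by (simp add: tsum_def)

text \<open>The product formula for inner products makes the norm of an elementary tensor the
  product of the two norms.\<close>

lemma htensor_bounded_bilinear:
  assumes "is_htensor t" shows "bounded_bilinear t"
proof -
  have "(norm (t x y))\<^sup>2 = (norm x * norm y)\<^sup>2" for x y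
  proof -
    have "complex_of_real ((norm (t x y))\<^sup>2) = complex_of_real ((norm x * norm y)\<^sup>2)"
      using assms cinner_self[of "t x y"] cinner_self[of x] cinner_self[of y]
      by (simp add: is_htensor_def power_mult_distrib)
    then show ?thesis using of_real_eq_iff by blast
  qed
  then have "norm (t x y) = norm x * norm y" for x y by (simp add: power2_eq_iff_nonneg)
  then show ?thesis using assms
    by unfold_locales (auto simp: is_htensor_def scaleR_scaleC intro!: exI[of _ 1])
qed

lemma cinner_htensor: "is_htensor t \<Longrightarrow> cinner (t x y) (t x' y') = cinner x x' * cinner y y'"
  by (simp add: is_htensor_def)

lemma htensor_scaleC:
  "is_htensor t \<Longrightarrow> t (scaleC c x) y = scaleC c (t x y)"
  "is_htensor t \<Longrightarrow> t x (scaleC c y) = scaleC c (t x y)"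
  by (simp_all add: is_htensor_def)

text \<open>Scalars are absorbed into the first leg, so plain sums of elementary tensors already
  contain the complex span.\<close>

lemma htensor_dense:
  assumes "is_htensor t" shows "closure (range (tsum t)) = UNIV"
proof -
  have "complex_span (range (case_prod t)) \<subseteq> range (tsum t)"
  proof
    fix v assume "v \<in> complex_span (range (case_prod t))"
    then obtain n :: nat and c w where v: "v = (\<Sum>i<n. scaleC (c i) (w i))"
      and w: "\<forall>i<n. w i \<in> range (case_prod t)"
      unfolding complex_span_def by blast
    from w have "\<forall>i<n. \<exists>a b. w i = t a b" by fastforce
    then obtain a b where "\<forall>i<n. w i = t (a i) (b i)" by metis
    then have "v = tsum t (map (\<lambda>i. (scaleC (c i) (a i), b i)) [0..<n])"
      by (simp add: tsum_upt v htensor_scaleC[OF assms])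
    then show "v \<in> range (tsum t)" by blast
  qed
  then show ?thesis
    using closure_mono assms unfolding is_htensor_def by blast
qed

text \<open>Allows results on the first leg to be reused on the second.\<close>

lemma htensor_swap:
  assumes "is_htensor t" shows "is_htensor (\<lambda>x y. t y x)"
proof -
  have "range (case_prod (\<lambda>x y. t y x)) = range (case_prod t)" by force
  then show ?thesis using assms by (simp add: is_htensor_def)
qed

text \<open>Uniqueness for the \<open>THE\<close> definitions of \<open>tensor_op\<close>,
  \<open>dagger\<close> and the slices. Real linearity suffices, so the antilinear case is
  covered.\<close>

lemma htensor_eqI:
  assumes "is_htensor t" and "bounded_linear f" and "bounded_linear g"
    and "\<And>x y. f (t x y) = g (t x y)"
  shows "f = g"
  by (rule dense_eq[OF assms(2,3) htensor_dense[OF assms(1)]])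
    (auto simp: linear_tsum bounded_linear.linear assms)

lemma htensor_extension:
  fixes t :: "'a::chilbert \<Rightarrow> 'b::chilbert \<Rightarrow> 'c::chilbert" and P :: "'a \<Rightarrow> 'b \<Rightarrow> 'd::chilbert"
  assumes t: "is_htensor t"
    and hom: "\<And>c x y. P (scaleC c x) y = scaleC (\<sigma> c) (P x y)" and \<sigma>: "\<sigma> (- 1) = - 1"
    and bound: "\<And>l. norm (tsum P l) \<le> K * norm (tsum t l)" and K: "0 \<le> K"
  obtains G where "semilinear_bounded \<sigma> G" and "\<And>x y. G (t x y) = P x y"
    and "\<And>v. norm (G v) \<le> K * norm v"
proof -
  define sc where "sc c l = map (\<lambda>(x, y). (scaleC c x, y)) l" for c and l :: "('a \<times> 'b) list"
  have sc_t: "tsum t (sc c l) = scaleC c (tsum t l)" for c l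
    unfolding sc_def by (induction l) (auto simp: htensor_scaleC[OF t] scaleC_add_right)
  have sc_P: "tsum P (sc c l) = scaleC (\<sigma> c) (tsum P l)" for c l
    unfolding sc_def by (induction l) (auto simp: hom scaleC_add_right)
  \<comment> \<open>The list \<open>l\<close> followed by the negative of \<open>l'\<close>
    represents 0 under \<open>t\<close>; the bound then kills the difference under
    \<open>P\<close>.\<close>
  have well: "tsum P l = tsum P l'" if "tsum t l = tsum t l'" for l l'
    using bound[of "l @ sc (- 1) l'"] that by (simp add: sc_t sc_P \<sigma>)
  define g where "g v = tsum P (SOME l. tsum t l = v)" for v
  have g: "g (tsum t l) = tsum P l" for l
  proof -
    have "tsum t (SOME l'. tsum t l' = tsum t l) = tsum t l" by (rule someI) (rule refl)
    then show ?thesis unfolding g_def by (rule well)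
  qed
  have h1: "\<And>x y. x \<in> range (tsum t) \<Longrightarrow> y \<in> range (tsum t) \<Longrightarrow> x + y \<in> range (tsum t)"
    by (auto simp flip: tsum_simps(3))
  have h2: "\<And>c x. x \<in> range (tsum t) \<Longrightarrow> scaleC c x \<in> range (tsum t)"
    by (auto simp flip: sc_t)
  have h3: "\<And>x y. x \<in> range (tsum t) \<Longrightarrow> y \<in> range (tsum t) \<Longrightarrow> g (x + y) = g x + g y"
    by (auto simp: g simp flip: tsum_simps(3))
  have h4: "\<And>c x. x \<in> range (tsum t) \<Longrightarrow> g (scaleC c x) = scaleC (\<sigma> c) (g x)"
    by (auto simp: g sc_P simp flip: sc_t)
  have h5: "\<And>x. x \<in> range (tsum t) \<Longrightarrow> norm (g x) \<le> K * norm x"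
    using bound g by auto
  show thesis
  proof (rule semilinear_extension[OF htensor_dense[OF t] h1 h2 h3 h4 h5 K])
    fix G assume G: "semilinear_bounded \<sigma> G" "\<And>x. x \<in> range (tsum t) \<Longrightarrow> G x = g x"
      "\<And>x. norm (G x) \<le> K * norm x"
    have "G (t x y) = P x y" for x y
      using G(2)[OF rangeI, of "[(x, y)]"] g[of "[(x, y)]"] by simp
    then show thesis using that G(1,3) by blast
  qed
qed

text \<open>\<open>N k = \<parallel>(a\<^sub>k \<otimes> 1) v\<parallel>\<close> with \<open>a\<^sub>k\<close> the iterated \<open>a\<^sup>* a\<close> satisfies the hypotheses of the
  recursion lemma, which turns a crude growth bound into the operator norm estimate.\<close>
lemma norm_tsum_left_le:
  fixes t :: "'a::chilbert \<Rightarrow> 'b::chilbert \<Rightarrow> 'c::chilbert"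
  assumes t: "is_htensor t" and a: "cbounded a"
  shows "norm (tsum (\<lambda>x y. t (a x) y) l) \<le> onorm a * norm (tsum t l)"
proof -
  interpret t: bounded_bilinear t by (rule htensor_bounded_bilinear[OF t])
  define N where "N k = norm (tsum (\<lambda>x y. t (star_pow a k x) y) l)" for k
  obtain L where L: "0 \<le> L" "\<And>x y. norm (t x y) \<le> norm x * norm y * L"
    using t.nonneg_bounded by blast
  define C where "C = tsum (\<lambda>x y. norm x * norm y * L) l"
  have "C \<ge> 0" unfolding C_def using L(1) by (induction l) auto
  have "N 0 \<le> norm (tsum t l) * onorm a"
  proof (rule quadratic_recursion_bound)
    show "0 \<le> onorm a" by (rule cbounded_onorm_nonneg[OF a])
    fix k
    let ?z = "star_pow a k"
    have z: "cbounded ?z" by (rule cbounded_star_pow[OF a])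
    \<comment> \<open>Moving one \<open>?z\<close> across the inner product leaves
      \<open>adj ?z \<circ> ?z\<close>, the next iterated square, on the other side.\<close>
    have "(N k)\<^sup>2 = cmod (cinner (tsum (\<lambda>x y. t (?z x) y) l) (tsum (\<lambda>x y. t (?z x) y) l))"
      by (simp add: N_def cinner_self del: of_real_power)
    also have "\<dots> = cmod (cinner (tsum t l) (tsum (\<lambda>x y. t (star_pow a (Suc k) x) y) l))"
      by (simp add: cinner_tsum_left cinner_tsum_right cinner_htensor[OF t] cinner_adj_right z)
    also have "\<dots> \<le> norm (tsum t l) * N (Suc k)"
      unfolding N_def by (rule cinner_cauchy_schwarz)
    finally show "(N k)\<^sup>2 \<le> norm (tsum t l) * N (Suc k)" .
    \<comment> \<open>Crude triangle inequality; its constant depends on the list \<open>l\<close>,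
      which the recursion lemma tolerates.\<close>
    have "norm (tsum (\<lambda>x y. t (?z x) y) l) \<le> tsum (\<lambda>x y. norm x * norm y * L) l * onorm a ^ 2 ^ k"
    proof (induction l)
      case (Cons p l)
      obtain x y where p: "p = (x, y)" by fastforce
      have "norm (t (?z x) y) \<le> norm (?z x) * norm y * L" by (rule L)
      also have "norm (?z x) \<le> onorm a ^ 2 ^ k * norm x"
        by (rule order_trans[OF cbounded_onorm[OF z] mult_right_mono[OF onorm_star_pow[OF a]]]) simp
      finally have "norm (t (?z x) y) \<le> onorm a ^ 2 ^ k * norm x * norm y * L"
        using L(1) by (simp add: mult_right_mono)
      then show ?case
        using Cons norm_triangle_ineq[of "t (?z x) y" "tsum (\<lambda>x y. t (?z x) y) l"]
        by (simp add: p algebra_simps)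
    qed simp
    also have "\<dots> \<le> C * 2 ^ k * onorm a ^ 2 ^ k"
    proof (rule mult_right_mono)
      show "tsum (\<lambda>x y. norm x * norm y * L) l \<le> C * 2 ^ k"
        using \<open>0 \<le> C\<close> mult_left_mono[of 1 "2 ^ k" C] by (simp add: C_def)
    qed (simp add: cbounded_onorm_nonneg a)
    finally show "N k \<le> C * 2 ^ k * onorm a ^ 2 ^ k" by (simp add: N_def)
  qed (auto simp: N_def)
  then show ?thesis by (simp add: N_def mult.commute)
qed

text \<open>\<open>norm_tsum_left_le\<close> is the bound under which
  \<open>htensor_extension\<close> applies; agreement on elementary tensors identifies the result
  with the \<open>THE\<close> operator.\<close>

lemma tensor_op_left:
  assumes t: "is_htensor t" and a: "cbounded a"
  shows "cbounded (tensor_op t a id)" and "tensor_op t a id (t x y) = t (a x) y"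
    and "norm (tensor_op t a id v) \<le> onorm a * norm v"
proof -
  obtain G where G: "semilinear_bounded (\<lambda>c. c) G" "\<And>x y. G (t x y) = t (a x) y"
    "\<And>v. norm (G v) \<le> onorm a * norm v"
    by (rule htensor_extension[OF t, of "\<lambda>x y. t (a x) y" "\<lambda>c. c" "onorm a"])
      (auto simp: cbounded_scaleC[OF a] htensor_scaleC[OF t] norm_tsum_left_le[OF t a]
        cbounded_onorm_nonneg[OF a])
  have "tensor_op t a id = G" unfolding tensor_op_def
  proof (rule the_equality)
    fix T assume "cbounded T \<and> (\<forall>x y. T (t x y) = t (a x) (id y))"
    then show "T = G" using G
      by (intro htensor_eqI[OF t]) (auto simp: cbounded_semilinear[symmetric] cbounded_bounded_linear)
  qed (use G in \<open>simp add: cbounded_semilinear\<close>)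
  then show "cbounded (tensor_op t a id)" "tensor_op t a id (t x y) = t (a x) y"
    "norm (tensor_op t a id v) \<le> onorm a * norm v"
    using G by (auto simp: cbounded_semilinear)
qed

lemma tensor_op_swap: "tensor_op t id b = tensor_op (\<lambda>x y. t y x) b id"
  unfolding tensor_op_def by (intro arg_cong[of _ _ The] ext) auto

lemma tensor_op_right:
  assumes t: "is_htensor t" and b: "cbounded b"
  shows "cbounded (tensor_op t id b)" and "tensor_op t id b (t x y) = t x (b y)"
    and "norm (tensor_op t id b v) \<le> onorm b * norm v"
  unfolding tensor_op_swap using tensor_op_left[OF htensor_swap[OF t] b] by auto

text \<open>The slice is the adjoint of \<open>w \<mapsto> t w \<Omega>\<close>, a map of norm
  \<open>norm \<Omega>\<close>. Pairing \<open>?w\<close> with itself through this duality gives the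
  bound.\<close>

lemma slice_id_tau:
  fixes t :: "'a::chilbert \<Rightarrow> 'a \<Rightarrow> 'c::chilbert"
  assumes t: "is_htensor t"
  shows "cbounded (slice_id_tau t \<Omega>)"
    and "slice_id_tau t \<Omega> (t x y) = scaleC (cinner y \<Omega>) x"
    and "norm (slice_id_tau t \<Omega> v) \<le> norm \<Omega> * norm v"
proof -
  define P :: "'a \<Rightarrow> 'a \<Rightarrow> 'a" where "P = (\<lambda>x y. scaleC (cinner y \<Omega>) x)"
  have norm_t: "norm (t w \<Omega>) = norm w * norm \<Omega>" for w
  proof -
    have "complex_of_real ((norm (t w \<Omega>))\<^sup>2) = complex_of_real ((norm w * norm \<Omega>)\<^sup>2)"
      unfolding cinner_self[symmetric] cinner_htensor[OF t]
      by (simp add: cinner_self power_mult_distrib)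
    then show ?thesis
      unfolding of_real_eq_iff by (simp add: power2_eq_iff_nonneg)
  qed
  have bound: "norm (tsum P l) \<le> norm \<Omega> * norm (tsum t l)" for l
  proof -
    let ?w = "tsum P l"
    have "(norm ?w)\<^sup>2 = cmod (cinner ?w ?w)" by (simp add: cinner_self del: of_real_power)
    also have "cinner ?w ?w = cinner (tsum t l) (t ?w \<Omega>)"
      unfolding cinner_tsum_left
      by (rule tsum_cong) (simp add: P_def cinner_htensor[OF t] cinner_scaleC_left mult.commute)
    also have "cmod \<dots> \<le> norm (tsum t l) * (norm ?w * norm \<Omega>)"
      using cinner_cauchy_schwarz[of "tsum t l" "t ?w \<Omega>"] by (simp add: norm_t)
    finally have "norm ?w * norm ?w \<le> norm ?w * (norm \<Omega> * norm (tsum t l))"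
      by (simp add: power2_eq_square mult_ac)
    then show ?thesis by (cases "?w = 0") auto
  qed
  obtain G where G: "semilinear_bounded (\<lambda>c. c) G" "\<And>x y. G (t x y) = P x y"
    "\<And>v. norm (G v) \<le> norm \<Omega> * norm v"
    by (rule htensor_extension[OF t, of P "\<lambda>c. c" "norm \<Omega>"])
      (auto simp: bound, simp add: P_def scaleC_scaleC mult.commute)
  have "slice_id_tau t \<Omega> = G" unfolding slice_id_tau_def
  proof (rule the_equality)
    fix T assume "cbounded T \<and> (\<forall>x y. T (t x y) = scaleC (cinner y \<Omega>) x)"
    then show "T = G" using G
      by (intro htensor_eqI[OF t])
        (auto simp: P_def cbounded_semilinear[symmetric] cbounded_bounded_linear)
  qed (use G in \<open>simp add: cbounded_semilinear P_def\<close>)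
  then show "cbounded (slice_id_tau t \<Omega>)" "slice_id_tau t \<Omega> (t x y) = scaleC (cinner y \<Omega>) x"
    "norm (slice_id_tau t \<Omega> v) \<le> norm \<Omega> * norm v"
    using G by (auto simp: cbounded_semilinear P_def)
qed

lemma slice_swap: "slice_tau_id t \<Omega> = slice_id_tau (\<lambda>x y. t y x) \<Omega>"
  unfolding slice_tau_id_def slice_id_tau_def by (intro arg_cong[of _ _ The] ext) auto

lemma slice_tau_id:
  assumes t: "is_htensor t"
  shows "cbounded (slice_tau_id t \<Omega>)"
    and "slice_tau_id t \<Omega> (t x y) = scaleC (cinner x \<Omega>) y"
  unfolding slice_swap using slice_id_tau[OF htensor_swap[OF t]] by auto

section \<open>Tracial von Neumann algebras\<close>

locale tracial_vna =
  fixes M :: "('h::chilbert \<Rightarrow> 'h) set" and \<Omega> :: 'h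
  assumes standard: "tracial_standard_form M \<Omega>"
begin

abbreviation J :: "'h \<Rightarrow> 'h" where "J \<equiv> Jop M \<Omega>"

lemma norm_Omega: "norm \<Omega> = 1"
  using standard by (simp add: tracial_standard_form_def)

lemma star_subalgebra: "unital_star_subalgebra M"
  using standard by (simp add: tracial_standard_form_def von_neumann_algebra_def)

lemma
  shows M_cbounded: "x \<in> M \<Longrightarrow> cbounded x" and M_id: "id \<in> M"
    and M_add: "x \<in> M \<Longrightarrow> y \<in> M \<Longrightarrow> (\<lambda>v. x v + y v) \<in> M"
    and M_comp: "x \<in> M \<Longrightarrow> y \<in> M \<Longrightarrow> x \<circ> y \<in> M"
    and M_scale: "x \<in> M \<Longrightarrow> (\<lambda>v. scaleC c (x v)) \<in> M"
    and M_adj: "x \<in> M \<Longrightarrow> adj x \<in> M"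
  using star_subalgebra by (auto simp: unital_star_subalgebra_def)

lemma trace: "x \<in> M \<Longrightarrow> y \<in> M \<Longrightarrow> cinner (x (y \<Omega>)) \<Omega> = cinner (y (x \<Omega>)) \<Omega>"
  using standard by (simp add: tracial_standard_form_def)

lemma cyclic: "closure ((\<lambda>x. x \<Omega>) ` M) = UNIV"
  using standard by (simp add: tracial_standard_form_def)

lemma separating: "x = y" if "x \<in> M" "y \<in> M" "x \<Omega> = y \<Omega>"
proof -
  have "(\<lambda>v. x v + scaleC (- 1) (y v)) \<in> M" using that M_add M_scale by blast
  then have "(\<lambda>v. x v + scaleC (- 1) (y v)) = (\<lambda>_. 0)"
    using standard that(3) by (simp add: tracial_standard_form_def)
  then show ?thesis by (auto simp: fun_eq_iff)
qed

text \<open>Both sides are traces of products of \<open>y\<close> and \<open>adj x\<close>, in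
  opposite orders. Hence \<open>x \<Omega> \<mapsto> adj x \<Omega>\<close> is isometric.\<close>

lemma cinner_adj_vec:
  assumes "x \<in> M" "y \<in> M" shows "cinner (adj x \<Omega>) (adj y \<Omega>) = cinner (y \<Omega>) (x \<Omega>)"
  using assms trace[of y "adj x"]
  by (simp add: cinner_adj_left cinner_adj_right M_cbounded M_adj)

text \<open>The assignment \<open>x \<Omega> \<mapsto> adj x \<Omega>\<close> is well defined since
  \<Omega> is separating, isometric by \<open>cinner_adj_vec\<close>, and densely defined since
  \<Omega> is cyclic.\<close>

lemma
  shows J_antilinear: "antilinear_bounded J" and J_vec: "y \<in> M \<Longrightarrow> J (y \<Omega>) = adj y \<Omega>"
    and norm_J_le: "norm (J v) \<le> norm v"
proof -
  define U where "U = (\<lambda>x. x \<Omega>) ` M"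
  define g where "g v = adj (inv_into M (\<lambda>x. x \<Omega>) v) \<Omega>" for v
  have inj: "inj_on (\<lambda>x. x \<Omega>) M" by (auto intro: inj_onI separating)
  have g: "g (x \<Omega>) = adj x \<Omega>" if "x \<in> M" for x
    using that by (simp add: g_def inv_into_f_f[OF inj])
  have UI: "x \<Omega> \<in> U" if "x \<in> M" for x using that by (simp add: U_def)
  have adj_plus: "adj (\<lambda>v. x v + y v) \<Omega> = adj x \<Omega> + adj y \<Omega>" if "x \<in> M" "y \<in> M" for x y
    by (rule cinner_eqI)
      (simp add: cinner_adj_right M_cbounded M_add that cinner_add_left cinner_add_right)
  have adj_scale: "adj (\<lambda>v. scaleC c (x v)) \<Omega> = scaleC (cnj c) (adj x \<Omega>)" if "x \<in> M" for c x
    by (rule cinner_eqI)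
      (simp add: cinner_adj_right M_cbounded M_scale that cinner_scaleC_left cinner_scaleC_right)
  have norm_adj: "norm (adj x \<Omega>) = norm (x \<Omega>)" if "x \<in> M" for x
    using cinner_adj_vec[OF that that] by (simp add: norm_cinner)
  have ext: "\<exists>G. antilinear_bounded G \<and> (\<forall>x\<in>M. G (x \<Omega>) = adj x \<Omega>) \<and> (\<forall>v. norm (G v) \<le> norm v)"
  proof (rule semilinear_extension[of U g cnj 1])
    show "closure U = UNIV" using cyclic by (simp add: U_def)
    show "u + v \<in> U" if "u \<in> U" "v \<in> U" for u v
      using that by (auto simp: U_def intro!: image_eqI[OF _ M_add])
    show "scaleC c u \<in> U" if "u \<in> U" for c u
      using that by (auto simp: U_def intro!: image_eqI[OF _ M_scale])
    show "g (u + v) = g u + g v" if "u \<in> U" "v \<in> U" for u v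
    proof -
      from that obtain x y where "x \<in> M" "y \<in> M" "u = x \<Omega>" "v = y \<Omega>"
        by (auto simp: U_def)
      then show ?thesis using g[OF M_add[of x y]] by (simp add: g adj_plus)
    qed
    show "g (scaleC c u) = scaleC (cnj c) (g u)" if "u \<in> U" for c u
    proof -
      from that obtain x where "x \<in> M" "u = x \<Omega>" by (auto simp: U_def)
      then show ?thesis using g[OF M_scale[of x c]] by (simp add: g adj_scale)
    qed
    show "norm (g u) \<le> 1 * norm u" if "u \<in> U" for u
      using that by (auto simp: U_def g norm_adj)
    fix G assume "semilinear_bounded cnj G" "\<And>x. x \<in> U \<Longrightarrow> G x = g x"
      "\<And>x. norm (G x) \<le> 1 * norm x"
    then show ?thesis by (intro exI[of _ G]) (auto simp: antilinear_semilinear UI g)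
  qed simp
  then obtain G where G: "antilinear_bounded G" "\<forall>x\<in>M. G (x \<Omega>) = adj x \<Omega>"
    "\<forall>v. norm (G v) \<le> norm v" by blast
  have "J = G" unfolding Jop_def
  proof (rule the_equality)
    fix G' assume "antilinear_bounded G' \<and> (\<forall>y\<in>M. G' (y \<Omega>) = adj y \<Omega>)"
    then show "G' = G" using G
      by (intro dense_eq[OF _ _ cyclic]) (auto simp: antilinear_bounded_linear)
  qed (use G in blast)
  then show "antilinear_bounded J" "y \<in> M \<Longrightarrow> J (y \<Omega>) = adj y \<Omega>" "norm (J v) \<le> norm v"
    using G by auto
qed

lemma bounded_linear_J: "bounded_linear J"
  by (rule antilinear_bounded_linear[OF J_antilinear])

lemma J_J [simp]: "J (J v) = v"
proof -
  have "J \<circ> J = id"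
    by (rule dense_eq[OF _ _ cyclic])
      (auto simp: bounded_linear_J comp_def bounded_linear_compose J_vec M_adj adj_adj M_cbounded
        bounded_linear_ident[unfolded id_def[symmetric]])
  then show ?thesis by (metis comp_apply id_apply)
qed

lemma J_Omega [simp]: "J \<Omega> = \<Omega>"
  using J_vec[OF M_id] by (simp add: adj_id)

lemma cinner_J_J: "cinner (J u) (J v) = cinner v u"
proof -
  have bl: "bounded_linear (\<lambda>v. cinner (J u) (J v))" "bounded_linear (\<lambda>v. cinner v u)"
    "bounded_linear (\<lambda>u. cinner (J u) (J v))" "bounded_linear (\<lambda>u. cinner v u)" for u v
    by (auto intro!: bounded_linear_intros bounded_linear_compose[OF _ bounded_linear_J]
        cinner.bounded_linear_left cinner.bounded_linear_right)
  have "(\<lambda>v. cinner (J (x \<Omega>)) (J v)) = (\<lambda>v. cinner v (x \<Omega>))" if "x \<in> M" for x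
    by (rule dense_eq[OF bl(1,2) cyclic]) (auto simp: J_vec that cinner_adj_vec)
  then have "(\<lambda>u. cinner (J u) (J v)) = (\<lambda>u. cinner v u)"
    by (intro dense_eq[OF bl(3,4) cyclic]) (auto simp: fun_eq_iff)
  then show ?thesis by (rule fun_cong)
qed

lemma cinner_J_left: "cinner (J u) v = cinner (J v) u"
  using cinner_J_J[of u "J v"] by simp

text \<open>Right multiplication by \<open>b\<close> is \<open>J \<circ> adj b \<circ> J\<close>,
  since \<open>J (adj b (adj y \<Omega>)) = y (b \<Omega>)\<close>. Boundedness and the norm
  estimate can be read off this formula.\<close>

lemma
  assumes b: "b \<in> M"
  shows right_act_cbounded: "cbounded (right_act M \<Omega> b)"
    and right_act_vec: "y \<in> M \<Longrightarrow> right_act M \<Omega> b (y \<Omega>) = y (b \<Omega>)"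
    and onorm_right_act: "onorm (right_act M \<Omega> b) \<le> onorm b"
proof -
  define R where "R = (\<lambda>v. J (adj b (J v)))"
  have bc: "cbounded (adj b)" by (simp add: M_cbounded M_adj b)
  have R_le: "norm (R v) \<le> onorm b * norm v" for v
  proof -
    have "norm (R v) \<le> norm (adj b (J v))" unfolding R_def by (rule norm_J_le)
    also have "\<dots> \<le> onorm b * norm (J v)" by (rule norm_adj_le[OF M_cbounded[OF b]])
    also have "\<dots> \<le> onorm b * norm v"
      by (intro mult_left_mono norm_J_le cbounded_onorm_nonneg M_cbounded b)
    finally show ?thesis .
  qed
  have R: "cbounded R"
  proof (rule cboundedI[OF _ _ R_le])
    show "R (u + v) = R u + R v" for u v
      using linear_add[OF bounded_linear.linear[OF bounded_linear_J]]
      by (simp add: R_def cbounded_add[OF bc])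
    show "R (scaleC c v) = scaleC c (R v)" for c v
      by (simp add: R_def antilinear_scaleC[OF J_antilinear] cbounded_scaleC[OF bc])
  qed
  have R_vec: "R (y \<Omega>) = y (b \<Omega>)" if "y \<in> M" for y
    using that b J_vec[OF M_comp[OF M_adj M_adj], of b y]
    by (simp add: R_def J_vec adj_comp M_cbounded M_adj adj_adj)
  have "right_act M \<Omega> b = R" unfolding right_act_def
  proof (rule the_equality)
    fix T assume "cbounded T \<and> (\<forall>y\<in>M. T (y \<Omega>) = (y \<circ> b) \<Omega>)"
    then show "T = R"
      by (intro dense_eq[OF _ _ cyclic]) (auto simp: cbounded_bounded_linear R R_vec)
  qed (use R R_vec in simp)
  then show "cbounded (right_act M \<Omega> b)" "y \<in> M \<Longrightarrow> right_act M \<Omega> b (y \<Omega>) = y (b \<Omega>)"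
    "onorm (right_act M \<Omega> b) \<le> onorm b"
    using R R_vec R_le by (auto intro: onorm_bound cbounded_onorm_nonneg M_cbounded b)
qed

text \<open>Applying \<open>J\<close> to both legs and exchanging them conjugates inner products, so
  it preserves norms of finite sums and extends with constant 1.\<close>

lemma
  fixes t :: "'h \<Rightarrow> 'h \<Rightarrow> 'k::chilbert"
  assumes t: "is_htensor t"
  shows dagger_antilinear: "antilinear_bounded (dagger M \<Omega> t)"
    and dagger_htensor: "dagger M \<Omega> t (t x y) = t (J y) (J x)"
    and norm_dagger_le: "norm (dagger M \<Omega> t v) \<le> norm v"
proof -
  define P where "P x y = t (J y) (J x)" for x y
  have iso: "norm (tsum P l) = norm (tsum t l)" for l
  proof -
    have "cinner (tsum P l) (tsum P l) = cnj (cinner (tsum t l) (tsum t l))"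
      unfolding cinner_tsum_left cinner_tsum_right
        linear_tsum[OF bounded_linear.linear[OF bounded_linear_cnj]]
      by (intro tsum_cong)
        (simp add: P_def cinner_htensor[OF t] cinner_J_J cinner_conj[symmetric] mult.commute)
    then show ?thesis by (simp add: norm_cinner)
  qed
  obtain G where G: "semilinear_bounded cnj G" "\<And>x y. G (t x y) = P x y"
    "\<And>v. norm (G v) \<le> 1 * norm v"
    by (rule htensor_extension[OF t, of P cnj 1])
      (auto simp: iso P_def antilinear_scaleC[OF J_antilinear] htensor_scaleC[OF t])
  have "dagger M \<Omega> t = G" unfolding dagger_def
  proof (rule the_equality)
    fix T assume "antilinear_bounded T \<and> (\<forall>x y. T (t x y) = t (J y) (J x))"
    then show "T = G" using G
      by (intro htensor_eqI[OF t])
        (auto simp: P_def antilinear_semilinear[symmetric] antilinear_bounded_linear)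
  qed (use G in \<open>simp add: antilinear_semilinear P_def\<close>)
  then show "antilinear_bounded (dagger M \<Omega> t)" "dagger M \<Omega> t (t x y) = t (J y) (J x)"
    "norm (dagger M \<Omega> t v) \<le> norm v"
    using G by (auto simp: antilinear_semilinear P_def)
qed

text \<open>An instance of the rule that an antiunitary involution can be moved to the other entry
  of the inner product, which then exchanges its entries.\<close>

lemma cinner_dagger:
  fixes t :: "'h \<Rightarrow> 'h \<Rightarrow> 'k::chilbert"
  assumes t: "is_htensor t"
  shows "cinner (dagger M \<Omega> t u) (t x y) = cinner (t (J y) (J x)) u"
proof -
  have "(\<lambda>u. cinner (dagger M \<Omega> t u) (t x y)) = (\<lambda>u. cinner (t (J y) (J x)) u)"
  proof (rule htensor_eqI[OF t])
    show "bounded_linear (\<lambda>u. cinner (dagger M \<Omega> t u) (t x y))"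
      by (rule bounded_linear_compose[OF cinner.bounded_linear_left
            antilinear_bounded_linear[OF dagger_antilinear[OF t]]])
    show "cinner (dagger M \<Omega> t (t a b)) (t x y) = cinner (t (J y) (J x)) (t a b)" for a b
      by (simp add: dagger_htensor[OF t] cinner_htensor[OF t] cinner_J_left[of b] cinner_J_left[of a])
  qed (rule cinner.bounded_linear_right)
  then show ?thesis by (rule fun_cong)
qed

end

section \<open>Real coassociative derivations\<close>

locale coassociative_derivation = tracial_vna M \<Omega>
  for M :: "('h::chilbert \<Rightarrow> 'h) set" and \<Omega> :: 'h +
  fixes t :: "'h \<Rightarrow> 'h \<Rightarrow> 'k::chilbert"
    and tA :: "'k \<Rightarrow> 'h \<Rightarrow> 'k3::chilbert" and tB :: "'h \<Rightarrow> 'k \<Rightarrow> 'k3"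
    and D :: "('h \<Rightarrow> 'h) set" and \<delta> :: "('h \<Rightarrow> 'h) \<Rightarrow> 'k"
  assumes t: "is_htensor t" and tA: "is_htensor tA" and tB: "is_htensor tB"
    and assoc: "\<forall>a b c. tA (t a b) c = tB a (t b c)"
    and deriv: "nc_derivation M \<Omega> t D \<delta>" and real: "real_derivation M \<Omega> t D \<delta>"
    and coassoc: "coassociative \<Omega> t tA tB D \<delta>"
    and one_dom: "t \<Omega> \<Omega> \<in> dom_adjoint \<Omega> D \<delta>"
begin

section \<open>The domain \<open>D\<close> and the adjoint of \<delta>\<close>

lemma
  shows D_M: "x \<in> D \<Longrightarrow> x \<in> M"
    and D_comp: "x \<in> D \<Longrightarrow> y \<in> D \<Longrightarrow> x \<circ> y \<in> D"
    and D_adj: "x \<in> D \<Longrightarrow> adj x \<in> D"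
    and \<delta>_scale: "x \<in> D \<Longrightarrow> \<delta> (\<lambda>v. scaleC c (x v)) = scaleC c (\<delta> x)"
    and \<delta>_comp: "x \<in> D \<Longrightarrow> y \<in> D \<Longrightarrow>
      \<delta> (x \<circ> y) = right_actK M \<Omega> t y (\<delta> x) + left_actK t x (\<delta> y)"
    and dense_D: "M \<subseteq> wot_closure D"
  using deriv by (auto simp: nc_derivation_def unital_star_subalgebra_def)

lemma D_cbounded: "x \<in> D \<Longrightarrow> cbounded x"
  by (simp add: D_M M_cbounded)

lemma \<delta>_adj: "x \<in> D \<Longrightarrow> \<delta> (adj x) = dagger M \<Omega> t (\<delta> x)"
  using real by (simp add: real_derivation_def)

text \<open>Collects for one choice of tensors what coassociativity and reality provide; the last
  formula is \<open>dagger\<close> applied term by term.\<close>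

lemma \<delta>_decomposition:
  assumes "x \<in> D"
  obtains n a b where "\<forall>i<n. a i \<in> D \<and> b i \<in> D"
    "\<delta> x = (\<Sum>i<(n::nat). t (a i \<Omega>) (b i \<Omega>))"
    "(\<Sum>i<n. tA (\<delta> (a i)) (b i \<Omega>)) = (\<Sum>i<n. tB (a i \<Omega>) (\<delta> (b i)))"
    "\<delta> (adj x) = (\<Sum>i<n. t (adj (b i) \<Omega>) (adj (a i) \<Omega>))"
proof -
  obtain n a b where ab: "\<forall>i<n. a i \<in> D \<and> b i \<in> D" "\<delta> x = (\<Sum>i<(n::nat). t (a i \<Omega>) (b i \<Omega>))"
    using coassoc assms unfolding coassociative_def by blast
  moreover have "(\<Sum>i<n. tA (\<delta> (a i)) (b i \<Omega>)) = (\<Sum>i<n. tB (a i \<Omega>) (\<delta> (b i)))"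
    using coassoc assms ab unfolding coassociative_def by blast
  moreover have "\<delta> (adj x) = (\<Sum>i<n. t (adj (b i) \<Omega>) (adj (a i) \<Omega>))"
    unfolding \<delta>_adj[OF assms] ab(2)
      linear_sum[OF bounded_linear.linear[OF antilinear_bounded_linear[OF dagger_antilinear[OF t]]]]
    by (intro sum.cong refl) (use ab(1) in \<open>simp add: dagger_htensor[OF t] J_vec D_M\<close>)
  ultimately show thesis using that by blast
qed

text \<open>Weak operator density, tested on the single pair \<open>(\<Omega>, u)\<close>, shows
  that \<open>u\<close> is orthogonal to all of \<open>M\<close> applied to \<Omega>. This gives
  uniqueness of the values of the adjoint.\<close>

lemma orthogonal_D:
  assumes "\<And>x. x \<in> D \<Longrightarrow> cinner (x \<Omega>) u = 0" shows "u = 0"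
proof (rule cinner_dense_eqI[OF cyclic])
  fix z assume "z \<in> (\<lambda>x. x \<Omega>) ` M"
  then obtain y where y: "y \<in> M" "z = y \<Omega>" by blast
  have "cmod (cinner (y \<Omega>) u) \<le> e" if "0 < e" for e
  proof -
    have "y \<in> wot_closure D" using y(1) dense_D by blast
    then have "\<exists>A\<in>D. \<forall>(\<xi>, \<eta>)\<in>{(\<Omega>, u)}. cmod (cinner (y \<xi> - A \<xi>) \<eta>) < e"
      using that unfolding wot_closure_def by blast
    then obtain A where "A \<in> D" "cmod (cinner (y \<Omega> - A \<Omega>) u) < e" by auto
    then show ?thesis by (simp add: cinner.diff_left assms)
  qed
  then have "cmod (cinner (y \<Omega>) u) \<le> 0" by (rule dense_ge)
  then show "cinner z u = cinner z 0" by (simp add: y(2))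
qed

lemma adjoint_opI:
  assumes "\<And>x. x \<in> D \<Longrightarrow> cinner (\<delta> x) \<zeta> = cinner (x \<Omega>) u"
  shows "\<zeta> \<in> dom_adjoint \<Omega> D \<delta>" and "adjoint_op \<Omega> D \<delta> \<zeta> = u"
proof -
  show "\<zeta> \<in> dom_adjoint \<Omega> D \<delta>" using assms by (auto simp: dom_adjoint_def)
  show "adjoint_op \<Omega> D \<delta> \<zeta> = u" unfolding adjoint_op_def
  proof (rule the_equality)
    fix u' assume "\<forall>x\<in>D. cinner (\<delta> x) \<zeta> = cinner (x \<Omega>) u'"
    then have "u' - u = 0"
      using assms by (intro orthogonal_D) (simp add: cinner.diff_right)
    then show "u' = u" by simp
  qed (use assms in blast)
qed

text \<open>The conjugate variable of free probability, written \<xi> in the overview.\<close>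

definition conjugate :: 'h where "conjugate = adjoint_op \<Omega> D \<delta> (t \<Omega> \<Omega>)"

abbreviation (input) \<rho> :: "('h \<Rightarrow> 'h) \<Rightarrow> 'h" where "\<rho> x \<equiv> slice_id_tau t \<Omega> (\<delta> x)"

definition T :: "('h \<Rightarrow> 'h) \<Rightarrow> 'h" where "T x = x conjugate - \<rho> x"

lemma cinner_conjugate: "x \<in> D \<Longrightarrow> cinner (\<delta> x) (t \<Omega> \<Omega>) = cinner (x \<Omega>) conjugate"
proof -
  obtain u where "\<And>x. x \<in> D \<Longrightarrow> cinner (\<delta> x) (t \<Omega> \<Omega>) = cinner (x \<Omega>) u"
    using one_dom by (auto simp: dom_adjoint_def)
  then show "x \<in> D \<Longrightarrow> cinner (\<delta> x) (t \<Omega> \<Omega>) = cinner (x \<Omega>) conjugate"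
    using adjoint_opI(2)[of "t \<Omega> \<Omega>" u] by (simp add: conjugate_def)
qed

text \<open>The tensor \<open>t \<Omega> \<Omega>\<close> is fixed by \<open>dagger\<close>, so
  reality of \<delta> makes \<open>conjugate\<close> invariant under \<open>J\<close>; this is the
  weak form tested on \<open>D\<close>.\<close>

lemma conjugate_selfadjoint:
  assumes "x \<in> D" shows "cinner conjugate (adj x \<Omega>) = cinner (x \<Omega>) conjugate"
proof -
  have "cinner (adj x \<Omega>) conjugate = cinner (t \<Omega> \<Omega>) (\<delta> x)"
    using cinner_conjugate[OF D_adj[OF assms]] by (simp add: \<delta>_adj assms cinner_dagger[OF t])
  then show ?thesis by (metis assms cinner_conj cinner_conjugate)
qed

section \<open>Bimodule actions and the formula for the adjoint\<close>

lemma linear_slice: "linear (slice_id_tau t \<Omega>)" "linear (slice_tau_id t \<Omega>)"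
  by (simp_all add: bounded_linear.linear cbounded_bounded_linear slice_id_tau[OF t] slice_tau_id[OF t])

lemma left_actK:
  assumes "x \<in> D"
  shows "linear (left_actK t x)" and "left_actK t x (t u v) = t (x u) v"
    and "norm (left_actK t x w) \<le> onorm x * norm w"
  unfolding left_actK_def using tensor_op_left[OF t D_cbounded[OF assms]]
  by (auto simp: bounded_linear.linear cbounded_bounded_linear)

lemma right_actK:
  assumes "x \<in> D"
  shows "linear (right_actK M \<Omega> t x)"
    and "y \<in> D \<Longrightarrow> right_actK M \<Omega> t x (t u (y \<Omega>)) = t u (y (x \<Omega>))"
    and "norm (right_actK M \<Omega> t x w) \<le> onorm x * norm w"
proof -
  note R = tensor_op_right[OF t right_act_cbounded[OF D_M[OF assms]]]
  show "linear (right_actK M \<Omega> t x)"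
    unfolding right_actK_def by (simp add: bounded_linear.linear cbounded_bounded_linear R)
  show "right_actK M \<Omega> t x (t u (y \<Omega>)) = t u (y (x \<Omega>))" if "y \<in> D"
    unfolding right_actK_def using that assms by (simp add: R right_act_vec D_M)
  show "norm (right_actK M \<Omega> t x w) \<le> onorm x * norm w"
    unfolding right_actK_def
    using order_trans[OF R(3) mult_right_mono[OF onorm_right_act[OF D_M[OF assms]]]] by simp
qed

text \<open>Evaluates the first Leibniz term of \<open>\<delta> (adj x \<circ> y)\<close>.\<close>

lemma right_actK_\<delta>_adj:
  assumes "y \<in> D" and "\<forall>i<n. a i \<in> D \<and> b i \<in> D"
    and "\<delta> (adj x) = (\<Sum>i<(n::nat). t (adj (b i) \<Omega>) (adj (a i) \<Omega>))"
  shows "right_actK M \<Omega> t y (\<delta> (adj x)) = (\<Sum>i<n. t (adj (b i) \<Omega>) (adj (a i) (y \<Omega>)))"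
  unfolding assms(3) linear_sum[OF right_actK(1)[OF assms(1)]]
  by (intro sum.cong refl) (simp add: right_actK assms D_adj)

text \<open>Apply the Leibniz rule to \<open>adj x \<circ> y\<close> and pair with
  \<open>t \<Omega> \<Omega>\<close>. The total is the pairing of \<open>y \<Omega>\<close> with
  \<open>x conjugate\<close>, the left action gives the desired left-hand side, and the right action
  gives the pairing with \<open>\<rho> x\<close>.\<close>

lemma cinner_T:
  assumes x: "x \<in> D" and y: "y \<in> D"
  shows "cinner (\<delta> y) (t (x \<Omega>) \<Omega>) = cinner (y \<Omega>) (T x)"
proof -
  have "cinner (left_actK t (adj x) (\<delta> y)) (t \<Omega> \<Omega>) = cinner (\<delta> y) (t (x \<Omega>) \<Omega>)"
  proof -
    obtain n a b where ab: "\<forall>i<n. a i \<in> D \<and> b i \<in> D"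
    and \<delta>y: "\<delta> y = (\<Sum>i<(n::nat). t (a i \<Omega>) (b i \<Omega>))"
    and co: "(\<Sum>i<n. tA (\<delta> (a i)) (b i \<Omega>)) = (\<Sum>i<n. tB (a i \<Omega>) (\<delta> (b i)))"
    and \<delta>y': "\<delta> (adj y) = (\<Sum>i<n. t (adj (b i) \<Omega>) (adj (a i) \<Omega>))"
    by (rule \<delta>_decomposition[OF y])
    show ?thesis
      by (simp add: \<delta>y linear_sum[OF left_actK(1)] left_actK(2) D_adj x cinner.sum_left
          cinner_htensor[OF t] cinner_adj_left D_cbounded)
  qed
  \<comment> \<open>Reality has exchanged the legs in \<open>\<delta> (adj x)\<close>; moving the
    adjoints back produces the slice of \<open>\<delta> x\<close> in its second leg.\<close>
  moreover have "cinner (right_actK M \<Omega> t y (\<delta> (adj x))) (t \<Omega> \<Omega>) = cinner (y \<Omega>) (\<rho> x)"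
  proof -
    obtain n a b where ab: "\<forall>i<n. a i \<in> D \<and> b i \<in> D"
    and \<delta>x: "\<delta> x = (\<Sum>i<(n::nat). t (a i \<Omega>) (b i \<Omega>))"
    and co: "(\<Sum>i<n. tA (\<delta> (a i)) (b i \<Omega>)) = (\<Sum>i<n. tB (a i \<Omega>) (\<delta> (b i)))"
    and \<delta>x': "\<delta> (adj x) = (\<Sum>i<n. t (adj (b i) \<Omega>) (adj (a i) \<Omega>))"
    by (rule \<delta>_decomposition[OF x])
    show ?thesis
      unfolding right_actK_\<delta>_adj[OF y ab \<delta>x']
      unfolding \<delta>x linear_sum[OF linear_slice(1)] cinner.sum_left cinner.sum_right
    proof (rule sum.cong[OF refl])
      fix i assume "i \<in> {..<n}"
      then have i: "cbounded (a i)" "cbounded (b i)" by (simp_all add: D_cbounded ab)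
      show "cinner (t (adj (b i) \<Omega>) (adj (a i) (y \<Omega>))) (t \<Omega> \<Omega>) =
          cinner (y \<Omega>) (slice_id_tau t \<Omega> (t (a i \<Omega>) (b i \<Omega>)))"
        by (simp add: cinner_htensor[OF t] slice_id_tau(2)[OF t] cinner_scaleC_right
            cinner_adj_left i cinner_conj[symmetric])
    qed
  qed
  moreover have "cinner (\<delta> (adj x \<circ> y)) (t \<Omega> \<Omega>) = cinner (y \<Omega>) (x conjugate)"
    using cinner_conjugate[OF D_comp[OF D_adj[OF x] y]]
    by (simp add: cinner_adj_left D_cbounded x)
  ultimately show ?thesis
    by (simp add: \<delta>_comp[OF D_adj[OF x] y] cinner_add_left T_def cinner.diff_right algebra_simps)
qed

text \<open>\<open>T\<close> commutes with left multiplication up to the Leibniz term of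
  \<open>\<rho> (adj y \<circ> x)\<close> in which \<delta> hits \<open>adj y\<close>.\<close>

lemma adj_T:
  assumes x: "x \<in> D" and y: "y \<in> D"
  shows "adj y (T x) = T (adj y \<circ> x) + slice_id_tau t \<Omega> (right_actK M \<Omega> t x (\<delta> (adj y)))"
proof -
  obtain n a b where ab: "\<forall>i<n. a i \<in> D \<and> b i \<in> D"
    and \<delta>x: "\<delta> x = (\<Sum>i<(n::nat). t (a i \<Omega>) (b i \<Omega>))"
    and co: "(\<Sum>i<n. tA (\<delta> (a i)) (b i \<Omega>)) = (\<Sum>i<n. tB (a i \<Omega>) (\<delta> (b i)))"
    and \<delta>x': "\<delta> (adj x) = (\<Sum>i<n. t (adj (b i) \<Omega>) (adj (a i) \<Omega>))"
    by (rule \<delta>_decomposition[OF x])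
  have lin: "linear (adj y)"
    by (intro bounded_linear.linear cbounded_bounded_linear D_cbounded D_adj y)
  have "slice_id_tau t \<Omega> (left_actK t (adj y) (\<delta> x)) = adj y (\<rho> x)"
    by (simp add: \<delta>x linear_sum[OF left_actK(1)] linear_sum[OF linear_slice(1)] linear_sum[OF lin]
        left_actK(2) D_adj y slice_id_tau(2)[OF t] cbounded_scaleC D_cbounded)
  then show ?thesis
    by (simp add: T_def \<delta>_comp[OF D_adj[OF y] x] linear_add[OF linear_slice(1)] linear_diff[OF lin])
qed

text \<open>Coassociativity enters here: paired with \<open>x \<otimes> 1 \<otimes> 1\<close> it shows that \<open>\<langle>\<rho> y, T x\<rangle>\<close> cancels
  the error term of \<open>adj_T\<close>.\<close>
lemma cinner_T_T:
  assumes x: "x \<in> D" and y: "y \<in> D"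
  shows "cinner (T y) (T x) = cinner conjugate (T (adj y \<circ> x))"
proof -
  obtain n a b where ab: "\<forall>i<n. a i \<in> D \<and> b i \<in> D"
    and \<delta>y: "\<delta> y = (\<Sum>i<(n::nat). t (a i \<Omega>) (b i \<Omega>))"
    and co: "(\<Sum>i<n. tA (\<delta> (a i)) (b i \<Omega>)) = (\<Sum>i<n. tB (a i \<Omega>) (\<delta> (b i)))"
    and \<delta>y': "\<delta> (adj y) = (\<Sum>i<n. t (adj (b i) \<Omega>) (adj (a i) \<Omega>))"
    by (rule \<delta>_decomposition[OF y])
  \<comment> \<open>The common value of \<open>cinner (\<rho> y) (T x)\<close> and of the error term
    paired with \<open>conjugate\<close>.\<close>
  define S where "S = (\<Sum>i<n. cinner (a i \<Omega>) (x \<Omega>) * cinner (b i \<Omega>) conjugate)"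
  have "cinner (\<rho> y) (T x) = (\<Sum>i<n. cinner (a i \<Omega>) (T x) * cinner (b i \<Omega>) \<Omega>)"
    by (simp add: \<delta>y linear_sum[OF linear_slice(1)] slice_id_tau(2)[OF t] cinner.sum_left
        cinner_scaleC_left mult.commute)
  \<comment> \<open>By \<open>cinner_T\<close>, the factor with \<open>T x\<close> becomes a pairing
    of \<open>\<delta> (a i)\<close>, so \<delta> now acts on the first legs and coassociativity can
    move it to the second.\<close>
  also have "\<dots> = (\<Sum>i<n. cinner (tA (\<delta> (a i)) (b i \<Omega>)) (tA (t (x \<Omega>) \<Omega>) \<Omega>))"
    by (intro sum.cong refl) (simp add: cinner_htensor[OF tA] cinner_T x ab)
  also have "\<dots> = cinner (\<Sum>i<n. tB (a i \<Omega>) (\<delta> (b i))) (tB (x \<Omega>) (t \<Omega> \<Omega>))"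
    by (simp add: co[symmetric] assoc[rule_format, symmetric] cinner.sum_left)
  also have "\<dots> = S"
    unfolding S_def cinner.sum_left
    by (intro sum.cong refl) (simp add: cinner_htensor[OF tB] cinner_conjugate ab)
  finally have 1: "cinner (\<rho> y) (T x) = S" .
  \<comment> \<open>The legs come exchanged and adjointed; \<open>conjugate_selfadjoint\<close>
    restores \<open>b i\<close> and yields the same sum.\<close>
  have "cinner conjugate (slice_id_tau t \<Omega> (right_actK M \<Omega> t x (\<delta> (adj y)))) = S"
    unfolding right_actK_\<delta>_adj[OF x ab \<delta>y'] S_def linear_sum[OF linear_slice(1)]
      cinner.sum_right
  proof (rule sum.cong[OF refl])
    fix i assume "i \<in> {..<n}"
    then have i: "a i \<in> D" "b i \<in> D" by (simp_all add: ab)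
    show "cinner conjugate (slice_id_tau t \<Omega> (t (adj (b i) \<Omega>) (adj (a i) (x \<Omega>)))) =
        cinner (a i \<Omega>) (x \<Omega>) * cinner (b i \<Omega>) conjugate"
      by (simp add: slice_id_tau(2)[OF t] cinner_scaleC_right conjugate_selfadjoint i
          cinner_adj_left D_cbounded cinner_conj[symmetric])
  qed
  then have "cinner (y conjugate) (T x) = cinner conjugate (T (adj y \<circ> x)) + S"
    using cinner_adj_right[OF D_cbounded[OF y], of conjugate "T x"]
    by (simp add: adj_T x y cinner_add_right)
  then show ?thesis using 1 by (simp add: T_def[of y] cinner.diff_left)
qed

section \<open>Growth along iterated squares and the norm bounds\<close>

lemma D_star_pow: "x \<in> D \<Longrightarrow> star_pow x k \<in> D"
  by (induction k) (auto intro: D_comp D_adj)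

text \<open>The Leibniz rule bounds \<delta> of \<open>adj z \<circ> z\<close> by
  \<open>2 * onorm z * norm (\<delta> z)\<close>, as \<open>dagger\<close> does not increase norms.
  Each step therefore contributes one factor 2.\<close>

lemma norm_\<delta>_star_pow:
  assumes x: "x \<in> D" and C: "0 \<le> C" "norm (\<delta> x) \<le> C * onorm x"
  shows "norm (\<delta> (star_pow x k)) \<le> C * 2 ^ k * onorm x ^ 2 ^ k"
proof (induction k)
  case (Suc k)
  let ?z = "star_pow x k"
  have z: "?z \<in> D" by (rule D_star_pow[OF x])
  have "norm (\<delta> (star_pow x (Suc k))) \<le> norm (right_actK M \<Omega> t ?z (\<delta> (adj ?z)))
      + norm (left_actK t (adj ?z) (\<delta> ?z))"
    by (simp add: \<delta>_comp D_adj z norm_triangle_ineq)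
  also have "\<dots> \<le> onorm ?z * norm (\<delta> (adj ?z)) + onorm ?z * norm (\<delta> ?z)"
    using right_actK(3)[OF z] left_actK(3)[OF D_adj[OF z]]
    by (intro add_mono) (simp_all add: onorm_adj D_cbounded z)
  also have "\<dots> \<le> onorm ?z * norm (\<delta> ?z) + onorm ?z * norm (\<delta> ?z)"
    by (intro add_mono mult_left_mono order_refl)
      (simp_all add: \<delta>_adj z norm_dagger_le[OF t] cbounded_onorm_nonneg D_cbounded)
  also have "\<dots> = 2 * (onorm ?z * norm (\<delta> ?z))" by simp
  also have "\<dots> \<le> 2 * (onorm x ^ 2 ^ k * (C * 2 ^ k * onorm x ^ 2 ^ k))"
    using Suc onorm_star_pow[OF D_cbounded[OF x]] cbounded_onorm_nonneg[OF D_cbounded[OF x]]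
    by (intro mult_left_mono mult_mono) auto
  also have "\<dots> = C * 2 ^ Suc k * onorm x ^ 2 ^ Suc k"
    by (simp add: power_mult power2_eq_square power_mult_distrib)
  finally show ?case .
qed (use C in simp)

lemma norm_T_le:
  assumes x: "x \<in> D" shows "norm (T x) \<le> norm conjugate * onorm x"
proof -
  have cb: "cbounded (star_pow x k)" for k by (rule cbounded_star_pow[OF D_cbounded[OF x]])
  have nonneg: "0 \<le> onorm x" by (rule cbounded_onorm_nonneg[OF D_cbounded[OF x]])
  \<comment> \<open>No boundedness of \<delta> is claimed: \<open>C\<close> depends on
    \<open>x\<close>. If \<open>onorm x = 0\<close>, then \<open>x\<close> and
    \<open>\<delta> x\<close> vanish.\<close>
  have "\<exists>C\<ge>0. norm (\<delta> x) \<le> C * onorm x"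
  proof (cases "onorm x = 0")
    case True
    then have "x v = 0" for v using cbounded_onorm[OF D_cbounded[OF x], of v] by simp
    then have "(\<lambda>v. scaleC 0 (x v)) = x" by auto
    then have "\<delta> x = 0" using \<delta>_scale[OF x, of 0] by simp
    then show ?thesis by auto
  next
    case False
    then show ?thesis using nonneg by (intro exI[of _ "norm (\<delta> x) / onorm x"]) simp
  qed
  then obtain C where C: "0 \<le> C" "norm (\<delta> x) \<le> C * onorm x" by blast
  have "norm (T (star_pow x 0)) \<le> norm conjugate * onorm x"
  \<comment> \<open>The recursion is \<open>cinner_T_T\<close> at equal arguments with
    Cauchy-Schwarz; growth holds with constant \<open>norm conjugate + C\<close>.\<close>
  proof (rule quadratic_recursion_bound)
    fix k
    let ?z = "star_pow x k"
    have z: "?z \<in> D" by (rule D_star_pow[OF x])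
    have "(norm (T ?z))\<^sup>2 = cmod (cinner (T ?z) (T ?z))"
      by (simp add: cinner_self del: of_real_power)
    also have "\<dots> \<le> norm conjugate * norm (T (star_pow x (Suc k)))"
      by (simp add: cinner_T_T z cinner_cauchy_schwarz)
    finally show "(norm (T ?z))\<^sup>2 \<le> norm conjugate * norm (T (star_pow x (Suc k)))" .
    have "norm (?z conjugate) \<le> onorm x ^ 2 ^ k * norm conjugate"
      by (rule order_trans[OF cbounded_onorm[OF cb] mult_right_mono[OF onorm_star_pow]])
        (simp_all add: D_cbounded x)
    also have "\<dots> \<le> 2 ^ k * (onorm x ^ 2 ^ k * norm conjugate)"
      using mult_right_mono[of 1 "2 ^ k" "onorm x ^ 2 ^ k * norm conjugate"] nonneg by simp
    finally have "norm (?z conjugate) \<le> norm conjugate * 2 ^ k * onorm x ^ 2 ^ k"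
      by (simp add: mult_ac)
    moreover have "norm (\<rho> ?z) \<le> C * 2 ^ k * onorm x ^ 2 ^ k"
      using slice_id_tau(3)[OF t, of \<Omega> "\<delta> ?z"] norm_\<delta>_star_pow[OF x C, of k]
      by (simp add: norm_Omega)
    ultimately show "norm (T ?z) \<le> (norm conjugate + C) * 2 ^ k * onorm x ^ 2 ^ k"
      using norm_triangle_ineq4[of "?z conjugate" "\<rho> ?z"] by (simp add: T_def distrib_right)
  qed (simp_all add: nonneg)
  then show ?thesis by simp
qed

lemma norm_slice_id_tau_\<delta>_le:
  assumes x: "x \<in> D" shows "norm (\<rho> x) \<le> 2 * norm conjugate * onorm x"
proof -
  have "norm (\<rho> x) \<le> norm (x conjugate) + norm (T x)"
    using norm_triangle_ineq4[of "x conjugate" "T x"] by (simp add: T_def)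
  then show ?thesis
    using norm_T_le[OF x] cbounded_onorm[OF D_cbounded[OF x], of conjugate]
    by (simp add: mult.commute)
qed

text \<open>\<open>dagger\<close> exchanges \<open>t \<Omega> (x \<Omega>)\<close> with
  \<open>t (adj x \<Omega>) \<Omega>\<close>, so reality reduces the second leg to
  \<open>cinner_T\<close> for the adjoints.\<close>

lemma cinner_J_T:
  assumes x: "x \<in> D" and y: "y \<in> D"
  shows "cinner (\<delta> y) (t \<Omega> (x \<Omega>)) = cinner (y \<Omega>) (J (T (adj x)))"
proof -
  have "cinner (\<delta> y) (t \<Omega> (x \<Omega>)) = cinner (t (adj x \<Omega>) \<Omega>) (\<delta> (adj y))"
    using \<delta>_adj[OF D_adj[OF y]] by (simp add: adj_adj D_cbounded y cinner_dagger[OF t] J_vec D_M x)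
  also have "\<dots> = cinner (T (adj x)) (J (y \<Omega>))"
    using cinner_T[OF D_adj[OF x] D_adj[OF y]] by (metis cinner_conj J_vec D_M y)
  also have "\<dots> = cinner (y \<Omega>) (J (T (adj x)))"
    by (metis cinner_J_left cinner_conj)
  finally show ?thesis .
qed

text \<open>Exchanging legs through \<open>dagger\<close> turns one slice into the other, conjugated
  by \<open>J\<close>.\<close>

lemma slice_tau_id_\<delta>:
  assumes x: "x \<in> D" shows "slice_tau_id t \<Omega> (\<delta> x) = J (\<rho> (adj x))"
proof -
  obtain n a b where ab: "\<forall>i<n. a i \<in> D \<and> b i \<in> D"
    and \<delta>x: "\<delta> x = (\<Sum>i<(n::nat). t (a i \<Omega>) (b i \<Omega>))"
    and co: "(\<Sum>i<n. tA (\<delta> (a i)) (b i \<Omega>)) = (\<Sum>i<n. tB (a i \<Omega>) (\<delta> (b i)))"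
    and \<delta>x': "\<delta> (adj x) = (\<Sum>i<n. t (adj (b i) \<Omega>) (adj (a i) \<Omega>))"
    by (rule \<delta>_decomposition[OF x])
  show ?thesis
    unfolding \<delta>x \<delta>x' linear_sum[OF linear_slice(1)] linear_sum[OF linear_slice(2)]
      linear_sum[OF bounded_linear.linear[OF bounded_linear_J]]
  proof (rule sum.cong[OF refl])
    fix i assume "i \<in> {..<n}"
    then have i: "a i \<in> D" "b i \<in> D" by (simp_all add: ab)
    show "slice_tau_id t \<Omega> (t (a i \<Omega>) (b i \<Omega>)) =
        J (slice_id_tau t \<Omega> (t (adj (b i) \<Omega>) (adj (a i) \<Omega>)))"
      by (simp add: slice_id_tau(2)[OF t] slice_tau_id(2)[OF t] antilinear_scaleC[OF J_antilinear]
          J_vec D_M D_adj i adj_adj D_cbounded cinner_adj_left cinner_conj[symmetric])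
  qed
qed

end

theorem theorem4p9:
  fixes M :: "('h::chilbert \<Rightarrow> 'h) set" and \<Omega> :: 'h
    and t :: "'h \<Rightarrow> 'h \<Rightarrow> 'k::chilbert"
    and tA :: "'k \<Rightarrow> 'h \<Rightarrow> 'k3::chilbert" and tB :: "'h \<Rightarrow> 'k \<Rightarrow> 'k3"
    and D :: "('h \<Rightarrow> 'h) set" and \<delta> :: "('h \<Rightarrow> 'h) \<Rightarrow> 'k"
  assumes "tracial_standard_form M \<Omega>"
    and "is_htensor t" and "is_htensor tA" and "is_htensor tB"
    and "\<forall>a b c. tA (t a b) c = tB a (t b c)"
    and "nc_derivation M \<Omega> t D \<delta>"
    and "real_derivation M \<Omega> t D \<delta>"
    and "coassociative \<Omega> t tA tB D \<delta>"
    and "t \<Omega> \<Omega> \<in> dom_adjoint \<Omega> D \<delta>"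
    and "x \<in> D"
  shows "t (x \<Omega>) \<Omega> \<in> dom_adjoint \<Omega> D \<delta>
      \<and> norm (adjoint_op \<Omega> D \<delta> (t (x \<Omega>) \<Omega>)) \<le> norm (adjoint_op \<Omega> D \<delta> (t \<Omega> \<Omega>)) * onorm x
    \<and> t \<Omega> (x \<Omega>) \<in> dom_adjoint \<Omega> D \<delta>
      \<and> norm (adjoint_op \<Omega> D \<delta> (t \<Omega> (x \<Omega>))) \<le> norm (adjoint_op \<Omega> D \<delta> (t \<Omega> \<Omega>)) * onorm x
    \<and> norm (slice_id_tau t \<Omega> (\<delta> x)) \<le> 2 * norm (adjoint_op \<Omega> D \<delta> (t \<Omega> \<Omega>)) * onorm x
    \<and> norm (slice_tau_id t \<Omega> (\<delta> x)) \<le> 2 * norm (adjoint_op \<Omega> D \<delta> (t \<Omega> \<Omega>)) * onorm x"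
proof -
  interpret coassociative_derivation M \<Omega> t tA tB D \<delta>
    using assms by unfold_locales
  note x = \<open>x \<in> D\<close>
  have left: "t (x \<Omega>) \<Omega> \<in> dom_adjoint \<Omega> D \<delta>" "adjoint_op \<Omega> D \<delta> (t (x \<Omega>) \<Omega>) = T x"
    by (rule adjoint_opI, erule cinner_T[OF x])+
  have right: "t \<Omega> (x \<Omega>) \<in> dom_adjoint \<Omega> D \<delta>"
    "adjoint_op \<Omega> D \<delta> (t \<Omega> (x \<Omega>)) = J (T (adj x))"
    by (rule adjoint_opI, erule cinner_J_T[OF x])+
  \<comment> \<open>The mirrored estimates are those for \<open>adj x\<close> followed by the
    contraction \<open>J\<close>; this equality returns their bounds to \<open>x\<close>.\<close>
  have onorm_x: "onorm (adj x) = onorm x" by (rule onorm_adj[OF D_cbounded[OF x]])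
  show ?thesis
    unfolding left(2) right(2) slice_tau_id_\<delta>[OF x] conjugate_def[symmetric]
    using left(1) right(1) norm_T_le[OF x] norm_slice_id_tau_\<delta>_le[OF x]
      order_trans[OF norm_J_le norm_T_le[OF D_adj[OF x]]]
      order_trans[OF norm_J_le norm_slice_id_tau_\<delta>_le[OF D_adj[OF x]]]
    by (simp add: onorm_x)
qed

end
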